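(* Let $X$ be a compact metrizable space equipped with a topological dynamical system (either a topological action on $X$ of a topological group or semi-group $\Lambda$, or an upper semi-continuous set-valued mapping $T:X\to 2^X$, as specified in the context), and assume that the set $\mathcal{M}$ of its invariant Borel probability measures is non-empty. Let $V$ be a separable real Banach space that is densely and continuously embedded in $C(X)$, and let $$V^{!}=\{f\in V: f\text{ has a unique maximizing measure}\}.$$ Then the complement $V\setminus V^{!}$ can be covered by countably many hypersurfaces in $V$; that is, there is a countable collection of hypersurfaces in $V$ whose union contains $V\setminus V^{!}$.
   Context: **Dynamical systems.** $X$ is a (non-empty) compact metrizable space. A topological dynamical system on $X$ is one of the following. (i) A topological action $\phi$ on $X$ of a topological group or semi-group $\Lambda$ (with identity element $1$): a continuous map $\phi:\Lambda\times X\to X$, $(\lambda,x)\mapsto\phi_\lambda(x)$, with $\phi_1=\mathrm{id}_X$ and $\phi_{\lambda'}\circ\phi_\lambda=\phi_{\lambda'\lambda}$ for all $\lambda,\lambda'\in\Lambda$. A Borel probability measure $\mu$ on $X$ is invariant if $\mu(\phi_\lambda^{-1}A)=\mu(A)$ for all $\lambda\in\Lambda$ and all Borel sets $A\subseteq X$. The case of a single continuous map $T:X\to X$ is included (the action of the non-negative integers by iterates; invariance means $\mu(T^{-1}A)=\mu(A)$ for all Borel $A$). (ii) A set-valued mapping $T:X\to 2^X$ that is upper semi-continuous: each $T(x)$ is a closed subset of $X$, and $\{x\in X:T(x)\subseteq U\}$ is open for every open $U\subseteq X$ (equivalently, the graph $\{(x,y):y\in T(x)\}$ is closed in $X\times X$).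 A Borel probability measure $\mu$ on $X$ is invariant if $\mu(A)\le\mu(T^{-1}A)$ for all Borel sets $A\subseteq X$, where $T^{-1}A=\{x\in X:T(x)\cap A\ne\emptyset\}$ (a universally measurable set, measured by the completion of $\mu$). $\mathcal{M}$ denotes the set of invariant Borel probability measures; it is always assumed to be non-empty. **Maximizing measures.** $C(X)$ is the space of continuous real-valued functions on $X$ with the supremum norm. For $f\in C(X)$, a measure $\mu\in\mathcal{M}$ is $f$-maximizing (a maximizing measure for $f$) if $\int f\,d\mu=\sup\{\int f\,d\nu:\nu\in\mathcal{M}\}$. **Embedding.** $V$ is densely and continuously embedded in $C(X)$ if there is a continuous injective linear map $V\to C(X)$ with dense image; elements of $V$ are identified with their images in $C(X)$. **Hypersurfaces.** A subset $S$ of the Banach space $V$ is a hypersurface if it is the graph of a function, defined on a hyperplane (i.e. codimension-one subspace) in $V$, that is the difference of two Lipschitz convex functions. That is, $S$ can be written as $S=\{f+(\phi(f)-\psi(f))g: f\in W\}$, where $g\in V$, $W$ is a closed codimension-one subspace of $V$ with $V=W+\{tg:t\in\mathbb{R}\}$, and $\phi,\psi:V\to\mathbb{R}$ are Lipschitz continuous convex functions. *)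

theory Defs
  imports "HOL-Probability.Probability"
begin

text \<open>
  The acting semigroup is given by explicit operations on a topological type rather than by a type
  class, so that additive semigroups such as (\<open>nat\<close>, \<open>+\<close>, \<open>0\<close>) can act directly; a topological
  group is a special case. In a set-valued system the sets \<open>T x\<close> may be empty.
\<close>

datatype ('l, 'x) dyn_system =
    Action "'l \<Rightarrow> 'l \<Rightarrow> 'l" 'l "'l \<Rightarrow> 'x \<Rightarrow> 'x"
  | Set_Valued "'x \<Rightarrow> 'x set"

definition topological_semigroup_with_one ::
    "('l::topological_space \<Rightarrow> 'l \<Rightarrow> 'l) \<Rightarrow> 'l \<Rightarrow> bool" where
  "topological_semigroup_with_one mul e \<longleftrightarrow>
     monoid mul e \<and> continuous_on UNIV (\<lambda>(a, b). mul a b)"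

definition topological_action ::
    "('l::topological_space \<Rightarrow> 'l \<Rightarrow> 'l) \<Rightarrow> 'l \<Rightarrow> ('l \<Rightarrow> 'x::topological_space \<Rightarrow> 'x) \<Rightarrow> bool" where
  "topological_action mul e \<phi> \<longleftrightarrow>
     continuous_on UNIV (\<lambda>(l, x). \<phi> l x) \<and>
     \<phi> e = id \<and> (\<forall>l' l. \<phi> l' \<circ> \<phi> l = \<phi> (mul l' l))"

definition upper_semicontinuous_map :: "('x::topological_space \<Rightarrow> 'x set) \<Rightarrow> bool" where
  "upper_semicontinuous_map T \<longleftrightarrow>
     (\<forall>x. closed (T x)) \<and> (\<forall>U. open U \<longrightarrow> open {x. T x \<subseteq> U})"

fun topological_dynamical_system ::
    "('l::topological_space, 'x::topological_space) dyn_system \<Rightarrow> bool" where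
  "topological_dynamical_system (Action mul e \<phi>) \<longleftrightarrow>
     topological_semigroup_with_one mul e \<and> topological_action mul e \<phi>"
| "topological_dynamical_system (Set_Valued T) \<longleftrightarrow> upper_semicontinuous_map T"

definition borel_probability_measures :: "'x::topological_space measure set" where
  "borel_probability_measures = {\<mu>. sets \<mu> = sets borel \<and> prob_space \<mu>}"

text \<open>
  In the set-valued case the preimage of a Borel set need not be Borel, but on a compact metrizable
  space it is universally measurable, so its value under the completion is its true measure.
\<close>

fun invariant_measure ::
    "('l::topological_space, 'x::topological_space) dyn_system \<Rightarrow> 'x measure \<Rightarrow> bool" where
  "invariant_measure (Action mul e \<phi>) \<mu> \<longleftrightarrow>
     (\<forall>l. \<forall>A\<in>sets borel. emeasure \<mu> (\<phi> l -` A) = emeasure \<mu> A)"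
| "invariant_measure (Set_Valued T) \<mu> \<longleftrightarrow>
     (\<forall>A\<in>sets borel. emeasure \<mu> A \<le> emeasure (completion \<mu>) {x. T x \<inter> A \<noteq> {}})"

definition invariant_measures ::
    "('l::topological_space, 'x::topological_space) dyn_system \<Rightarrow> 'x measure set" where
  "invariant_measures D = {\<mu> \<in> borel_probability_measures. invariant_measure D \<mu>}"

definition maximizing_measure ::
    "('l::topological_space, 'x::topological_space) dyn_system \<Rightarrow> ('x \<Rightarrow>\<^sub>C real) \<Rightarrow> 'x measure \<Rightarrow> bool"
  where
  "maximizing_measure D f \<mu> \<longleftrightarrow>
     \<mu> \<in> invariant_measures D \<and>
     (\<integral>x. f x \<partial>\<mu>) = (SUP \<nu>\<in>invariant_measures D. \<integral>x. f x \<partial>\<nu>)"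

text \<open>
  For compact \<open>'x\<close> the type \<open>'x \<Rightarrow>\<^sub>C real\<close> of bounded continuous functions is the space of all
  continuous real functions with the supremum norm.
\<close>

definition dense_continuous_embedding ::
    "('v::real_normed_vector \<Rightarrow> ('x::topological_space \<Rightarrow>\<^sub>C real)) \<Rightarrow> bool" where
  "dense_continuous_embedding J \<longleftrightarrow>
     linear J \<and> continuous_on UNIV J \<and> inj J \<and> closure (range J) = UNIV"

definition uniquely_maximized ::
    "('l::topological_space, 'x::topological_space) dyn_system \<Rightarrow> ('v \<Rightarrow> ('x \<Rightarrow>\<^sub>C real)) \<Rightarrow> 'v set" where
  "uniquely_maximized D J = {f. \<exists>!\<mu>. maximizing_measure D (J f) \<mu>}"

definition codimension_one :: "'v::real_vector set \<Rightarrow> bool" where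
  "codimension_one W \<longleftrightarrow> subspace W \<and> (\<exists>v. v \<notin> W \<and> span (insert v W) = UNIV)"

definition hypersurface :: "'v::real_normed_vector set \<Rightarrow> bool" where
  "hypersurface S \<longleftrightarrow>
     (\<exists>W g \<phi> \<psi>.
        closed W \<and> codimension_one W \<and> UNIV = {w + t *\<^sub>R g | w t. w \<in> W} \<and>
        convex_on UNIV \<phi> \<and> (\<exists>L. L-lipschitz_on UNIV \<phi>) \<and>
        convex_on UNIV \<psi> \<and> (\<exists>L. L-lipschitz_on UNIV \<psi>) \<and>
        S = {f + (\<phi> f - \<psi> f) *\<^sub>R g | f. f \<in> W})"

end

theory Submission
  imports Defs
begin

text \<open>
  The maximal value \<open>p f\<close> of \<open>\<integral>f d\<mu>\<close> over the invariant measures is a supremum of linear functionals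
  of \<open>f\<close>, hence a convex Lipschitz function on \<open>V\<close>. If \<open>f\<close> has two different maximizing measures
  \<open>\<mu>\<close> and \<open>\<nu>\<close>, then by density some \<open>g\<close> from a fixed countable dense set has
  \<open>\<integral>g d\<mu> < r < s < \<integral>g d\<nu>\<close> with rational \<open>r\<close>, \<open>s\<close>, and \<open>t \<mapsto> p (f + t g)\<close> has a kink at \<open>0\<close>: its left
  slope is at most \<open>r\<close> and its right slope at least \<open>s\<close>. So it suffices to cover, for each of the
  countably many triples \<open>(g, r, s)\<close>, the set of all such kinks by one hypersurface. This is an idea of
  Zajicek: for \<open>r \<le> c \<le> s\<close> put \<open>h\<^sub>c w = inf\<^sub>t (p (w + t g) - c t)\<close>. This is again convex and Lipschitz,
  and if \<open>w + t\<^sub>0 g\<close> is a kink, the infimum is attained at \<open>t\<^sub>0\<close> for \<^emph>\<open>every\<close> \<open>c\<close> between the two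
  slopes. Subtracting \<open>c = s\<close> from \<open>c = r\<close> gives \<open>t\<^sub>0 = (h\<^sub>r w - h\<^sub>s w) / (s - r)\<close>, so the kinks lie on
  the graph of a difference of two Lipschitz convex functions (\<open>kinks_in_hypersurface\<close>,
  \<open>nonunique_maximizers_covered\<close>).

  The other half of the theorem is that a maximizing measure exists, which follows from weak compactness of the
  set of invariant measures. Sequential compactness of all Borel probability measures on \<open>X\<close> is
  reduced to Helly's theorem on the real line (\<open>weak_sequential_compactness\<close>): there is an injective
  Borel map \<open>S\<close> from \<open>X\<close> into a compact set of reals whose inverse extends to a continuous map \<open>\<pi>\<close>
  on the closure \<open>C\<close> of its range. Measures are pushed forward by \<open>S\<close>, a weak limit is taken there, and
  the limit, which lives on \<open>C\<close>, is pushed back by \<open>\<pi>\<close>.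

  Weak limits of invariant measures are invariant. For an action, invariance is a family of equations
  between integrals of continuous functions. For a set-valued map the defining inequality passes to
  the limit for closed sets \<open>A\<close> by upper semi-continuity; it then extends to Borel sets \<open>A\<close> because
  the preimage of \<open>A\<close> is analytic, hence measurable for the completed measure, and because Borel sets
  can be approximated from inside by closed sets. Both facts follow from the capacitability of
  analytic sets (\<open>analytic_capacitability\<close>).
\<close>

section \<open>Kinks of a convex Lipschitz function\<close>

text \<open>
  The infimal projection of \<open>p - c t\<close> along the line in direction \<open>g\<close>; up to a sign, the value at \<open>c\<close> of
  the convex conjugate of \<open>t \<mapsto> p (v + t g)\<close>.
\<close>

definition tilted_minimum :: "('v::real_vector \<Rightarrow> real) \<Rightarrow> 'v \<Rightarrow> real \<Rightarrow> 'v \<Rightarrow> real" where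
  "tilted_minimum p g c v = (INF t. p (v + t *\<^sub>R g) - c * t)"

text \<open>
  A functional below \<open>p\<close> with slope at most \<open>c\<close> controls the tilted values for \<open>t \<le> 0\<close>, one with slope
  at least \<open>c\<close> controls them for \<open>t \<ge> 0\<close>; so the infimum defining \<open>tilted_minimum\<close> is genuine.
\<close>

lemma tilted_values_bdd_below:
  assumes "linear l1" "linear l2" "\<And>v. l1 v \<le> p v" "\<And>v. l2 v \<le> p v" "l1 g \<le> c" "c \<le> l2 g"
  shows "bdd_below (range (\<lambda>t. p (v + t *\<^sub>R g) - c * t))"
proof (rule bdd_belowI2)
  fix t :: real
  have e1: "l1 (v + t *\<^sub>R g) = l1 v + t * l1 g" and e2: "l2 (v + t *\<^sub>R g) = l2 v + t * l2 g"
    using assms(1,2) by (simp_all add: linear_add linear_cmul)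
  show "min (l1 v) (l2 v) \<le> p (v + t *\<^sub>R g) - c * t"
  proof (cases "t \<le> 0")
    case True
    then have "c * t \<le> t * l1 g" using assms(5) by (metis mult.commute mult_left_mono_neg)
    then show ?thesis using assms(3)[of "v + t *\<^sub>R g"] e1 by linarith
  next
    case False
    then have "c * t \<le> t * l2 g" using assms(6) by (simp add: mult.commute)
    then show ?thesis using assms(4)[of "v + t *\<^sub>R g"] e2 by linarith
  qed
qed

lemma tilted_minimum_le:
  assumes "bdd_below (range (\<lambda>t. p (v + t *\<^sub>R g) - c * t))"
  shows "tilted_minimum p g c v \<le> p (v + t *\<^sub>R g) - c * t"
  unfolding tilted_minimum_def by (rule cINF_lower[OF assms]) simp

lemma tilted_minimum_approx:
  assumes "tilted_minimum p g c v < a"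
  obtains t where "p (v + t *\<^sub>R g) - c * t < a"
proof -
  have "\<exists>t. p (v + t *\<^sub>R g) - c * t < a"
  proof (rule ccontr)
    assume "\<not> ?thesis"
    then have "a \<le> tilted_minimum p g c v"
      unfolding tilted_minimum_def by (intro cINF_greatest) (auto simp: not_less)
    then show False using assms by simp
  qed
  then show ?thesis using that by blast
qed

text \<open>
  The expression \<open>p (v + t g) - c t\<close> is jointly convex in \<open>(v, t)\<close>, and minimizing a jointly convex
  function over one variable leaves a convex function of the other.
\<close>

lemma convex_on_tilted_minimum:
  assumes p: "convex_on UNIV p"
    and bdd: "\<And>v. bdd_below (range (\<lambda>t. p (v + t *\<^sub>R g) - c * t))"
  shows "convex_on UNIV (tilted_minimum p g c)"
proof (rule convex_onI)
  fix u :: real and x y assume u: "0 < u" "u < 1"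
  let ?h = "tilted_minimum p g c"
  show "?h ((1 - u) *\<^sub>R x + u *\<^sub>R y) \<le> (1 - u) * ?h x + u * ?h y"
  proof (rule field_le_epsilon)
    fix e :: real assume "0 < e"
    obtain t1 where t1: "p (x + t1 *\<^sub>R g) - c * t1 < ?h x + e"
      using tilted_minimum_approx[of p g c x "?h x + e"] \<open>0 < e\<close> by auto
    obtain t2 where t2: "p (y + t2 *\<^sub>R g) - c * t2 < ?h y + e"
      using tilted_minimum_approx[of p g c y "?h y + e"] \<open>0 < e\<close> by auto
    let ?t = "(1 - u) * t1 + u * t2"
    have "?h ((1 - u) *\<^sub>R x + u *\<^sub>R y)
        \<le> p (((1 - u) *\<^sub>R x + u *\<^sub>R y) + ?t *\<^sub>R g) - c * ?t"
      by (rule tilted_minimum_le[OF bdd])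
    also have "((1 - u) *\<^sub>R x + u *\<^sub>R y) + ?t *\<^sub>R g
        = (1 - u) *\<^sub>R (x + t1 *\<^sub>R g) + u *\<^sub>R (y + t2 *\<^sub>R g)"
      by (simp add: algebra_simps)
    also have "p \<dots> \<le> (1 - u) * p (x + t1 *\<^sub>R g) + u * p (y + t2 *\<^sub>R g)"
      using convex_onD[OF p, of u] u by simp
    finally have "?h ((1 - u) *\<^sub>R x + u *\<^sub>R y)
        \<le> (1 - u) * (p (x + t1 *\<^sub>R g) - c * t1) + u * (p (y + t2 *\<^sub>R g) - c * t2)"
      by (simp add: algebra_simps)
    also have "\<dots> \<le> (1 - u) * (?h x + e) + u * (?h y + e)"
      using t1 t2 u by (intro add_mono mult_left_mono) auto
    finally show "?h ((1 - u) *\<^sub>R x + u *\<^sub>R y) \<le> (1 - u) * ?h x + u * ?h y + e"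
      by (simp add: algebra_simps)
  qed
qed simp

text \<open>
  An infimum of functions with a common Lipschitz constant has the same constant.
\<close>

lemma lipschitz_on_tilted_minimum:
  fixes p :: "'v::real_normed_vector \<Rightarrow> real"
  assumes p: "B-lipschitz_on UNIV p"
    and bdd: "\<And>v. bdd_below (range (\<lambda>t. p (v + t *\<^sub>R g) - c * t))"
  shows "B-lipschitz_on UNIV (tilted_minimum p g c)"
proof -
  let ?h = "tilted_minimum p g c"
  have le: "?h x \<le> ?h y + B * dist x y" for x y
  proof (rule field_le_epsilon)
    fix e :: real assume "0 < e"
    obtain t where t: "p (y + t *\<^sub>R g) - c * t < ?h y + e"
      using tilted_minimum_approx[of p g c y "?h y + e"] \<open>0 < e\<close> by auto
    have "p (x + t *\<^sub>R g) \<le> p (y + t *\<^sub>R g) + B * dist x y"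
      using lipschitz_onD[OF p, of "x + t *\<^sub>R g" "y + t *\<^sub>R g"] by (simp add: dist_real_def)
    then show "?h x \<le> ?h y + B * dist x y + e"
      using tilted_minimum_le[OF bdd, of x t] t by linarith
  qed
  show ?thesis
  proof (rule lipschitz_onI)
    show "dist (?h x) (?h y) \<le> B * dist x y" for x y
      using le[of x y] le[of y x] by (simp add: dist_real_def dist_commute abs_le_iff)
  qed (rule lipschitz_on_nonneg[OF p])
qed

text \<open>
  Left of \<open>t0\<close> the subgradient \<open>a \<le> c\<close> keeps the tilted values above the one at \<open>t0\<close>, right of \<open>t0\<close>
  the subgradient \<open>b \<ge> c\<close> does.
\<close>

lemma tilted_minimum_at_kink:
  assumes bdd: "bdd_below (range (\<lambda>t. p (v + t *\<^sub>R g) - c * t))"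
    and a: "\<And>t. p (v + t0 *\<^sub>R g) + t * a \<le> p (v + t0 *\<^sub>R g + t *\<^sub>R g)" "a \<le> c"
    and b: "\<And>t. p (v + t0 *\<^sub>R g) + t * b \<le> p (v + t0 *\<^sub>R g + t *\<^sub>R g)" "c \<le> b"
  shows "tilted_minimum p g c v = p (v + t0 *\<^sub>R g) - c * t0"
proof (rule antisym[OF tilted_minimum_le[OF bdd]])
  show "p (v + t0 *\<^sub>R g) - c * t0 \<le> tilted_minimum p g c v"
    unfolding tilted_minimum_def
  proof (rule cINF_greatest)
    fix t :: real
    have eq: "v + t0 *\<^sub>R g + (t - t0) *\<^sub>R g = v + t *\<^sub>R g" by (simp add: algebra_simps)
    show "p (v + t0 *\<^sub>R g) - c * t0 \<le> p (v + t *\<^sub>R g) - c * t"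
    proof (cases "t \<le> t0")
      case True
      then have "(t - t0) * c \<le> (t - t0) * a" using a(2) by (simp add: mult_left_mono_neg)
      then show ?thesis using a(1)[of "t - t0"] eq by (simp add: algebra_simps)
    next
      case False
      then have "(t - t0) * c \<le> (t - t0) * b" using b(2) by (simp add: mult_left_mono)
      then show ?thesis using b(1)[of "t - t0"] eq by (simp add: algebra_simps)
    qed
  qed simp
qed

lemma kernel_hyperplane:
  fixes k :: "'v::real_normed_vector \<Rightarrow> real"
  assumes k: "bounded_linear k" and g: "k g \<noteq> 0"
  shows "closed {v. k v = 0}" "codimension_one {v. k v = 0}"
    "k (f - (k f / k g) *\<^sub>R g) = 0"
proof -
  interpret k: bounded_linear k by fact
  show "closed {v. k v = 0}"
    by (intro closed_Collect_eq continuous_intros k.continuous_on)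
  show z: "k (f - (k f / k g) *\<^sub>R g) = 0" for f
    using g by (simp add: k.diff k.scaleR)
  have "subspace {v. k v = 0}"
    by (auto simp: subspace_def k.add k.scaleR k.zero)
  moreover have "span (insert g {v. k v = 0}) = UNIV"
  proof -
    have "f \<in> span (insert g {v. k v = 0})" for f
    proof -
      have "f - (k f / k g) *\<^sub>R g \<in> span {v. k v = 0}" using z[of f] by (intro span_base) simp
      then show ?thesis unfolding span_insert by blast
    qed
    then show ?thesis by blast
  qed
  ultimately show "codimension_one {v. k v = 0}"
    unfolding codimension_one_def using g by blast
qed

text \<open>
  The functionals \<open>l1\<close>, \<open>l2\<close> serve two purposes: they make the tilted minima finite, and the kernel of
  their difference is a closed hyperplane transversal to \<open>g\<close>, over which the hypersurface is a graph.
\<close>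

lemma kinks_in_hypersurface:
  fixes p :: "'v::real_normed_vector \<Rightarrow> real"
  assumes conv: "convex_on UNIV p" and lip: "B-lipschitz_on UNIV p"
    and l: "bounded_linear l1" "bounded_linear l2" "\<And>v. l1 v \<le> p v" "\<And>v. l2 v \<le> p v"
    and rs: "l1 g \<le> r" "r < s" "s \<le> l2 g"
  shows "\<exists>S. hypersurface S \<and>
    {f. (\<exists>a\<le>r. \<forall>t. p f + t * a \<le> p (f + t *\<^sub>R g)) \<and>
        (\<exists>b\<ge>s. \<forall>t. p f + t * b \<le> p (f + t *\<^sub>R g))} \<subseteq> S"
proof -
  let ?k = "\<lambda>v. l2 v - l1 v"
  let ?W = "{v. ?k v = 0}"
  have k: "bounded_linear ?k" using l(1,2) by (intro bounded_linear_sub)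
  have kg: "?k g \<noteq> 0" using rs by simp
  note W = kernel_hyperplane[OF k kg]
  have bdd: "bdd_below (range (\<lambda>t. p (v + t *\<^sub>R g) - c * t))" if "r \<le> c" "c \<le> s" for c v
    using tilted_values_bdd_below[OF bounded_linear.linear[OF l(1)] bounded_linear.linear[OF l(2)]
        l(3,4), of g c v] rs that by auto
  (* At a kink \<open>w + t0 g\<close> the tilted minimum is \<open>p (w + t0 g) - c t0\<close> for \<open>c = r\<close> and for \<open>c = s\<close>, so
     \<open>h r w - h s w\<close> is \<open>t0\<close>. *)
  define h where "h c v = tilted_minimum p g c v / (s - r)" for c v
  have conv_h: "convex_on UNIV (h c)" and lip_h: "\<exists>L. L-lipschitz_on UNIV (h c)"
    if c: "r \<le> c" "c \<le> s" for c
  proof -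
    have eq: "h c = (\<lambda>v. (1 / (s - r)) * tilted_minimum p g c v)" by (auto simp: h_def)
    show "convex_on UNIV (h c)"
      unfolding eq using rs by (intro convex_on_cmul convex_on_tilted_minimum[OF conv bdd[OF c]]) auto
    show "\<exists>L. L-lipschitz_on UNIV (h c)"
      unfolding eq using lipschitz_on_cmult_real[OF lipschitz_on_tilted_minimum[OF lip bdd[OF c]]]
      by blast
  qed
  define S where "S = {f + (h r f - h s f) *\<^sub>R g | f. f \<in> ?W}"
  have "UNIV = {w + t *\<^sub>R g | w t. w \<in> ?W}"
  proof -
    have "f \<in> {w + t *\<^sub>R g | w t. w \<in> ?W}" for f
      using W(3)[of f] by (auto intro!: exI[of _ "f - (?k f / ?k g) *\<^sub>R g"] exI[of _ "?k f / ?k g"])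
    then show ?thesis by blast
  qed
  then have "hypersurface S"
    unfolding hypersurface_def S_def using W(1,2) conv_h[of r] lip_h[of r] conv_h[of s] lip_h[of s] rs(2)
    by (intro exI[of _ ?W] exI[of _ g] exI[of _ "h r"] exI[of _ "h s"] conjI) auto
  moreover have "f \<in> S"
    if a: "a \<le> r" "\<forall>t. p f + t * a \<le> p (f + t *\<^sub>R g)"
      and b: "b \<ge> s" "\<forall>t. p f + t * b \<le> p (f + t *\<^sub>R g)" for f a b
  proof -
    define t0 where "t0 = ?k f / ?k g"
    define w where "w = f - t0 *\<^sub>R g"
    have f: "f = w + t0 *\<^sub>R g" and w: "w \<in> ?W" using W(3)[of f] by (simp_all add: w_def t0_def)
    have val: "tilted_minimum p g c w = p f - c * t0" if "r \<le> c" "c \<le> s" for c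
      using tilted_minimum_at_kink[OF bdd[OF that, of w], of t0 a b] a b that
      unfolding f[symmetric] by auto
    have "h r w - h s w = t0"
      unfolding h_def val[of r, OF order.refl less_imp_le[OF rs(2)]]
        val[of s, OF less_imp_le[OF rs(2)] order.refl]
      using rs(2) by (simp add: diff_divide_distrib[symmetric] field_simps)
    then show ?thesis unfolding S_def using f w by auto
  qed
  ultimately show ?thesis by blast
qed

text \<open>
  A point where two members of \<open>\<L>\<close> attain the supremum is a kink in every direction that separates
  the two. By separability countably many directions suffice, and rational bounds on the two slopes
  leave countably many sets of kinks.
\<close>

lemma nonunique_maximizers_covered:
  fixes \<L> :: "('v::real_normed_vector \<Rightarrow> real) set"
  assumes sep: "separable_space (euclidean :: 'v topology)"
    and lin: "\<And>l. l \<in> \<L> \<Longrightarrow> linear l" and bound: "\<And>l v. l \<in> \<L> \<Longrightarrow> \<bar>l v\<bar> \<le> B * norm v"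
  shows "\<exists>\<H> :: 'v set set. countable \<H> \<and> (\<forall>S\<in>\<H>. hypersurface S) \<and>
    {v. \<exists>k\<in>\<L>. \<exists>l\<in>\<L>. k \<noteq> l \<and> k v = (SUP l\<in>\<L>. l v) \<and> l v = (SUP l\<in>\<L>. l v)} \<subseteq> \<Union>\<H>"
proof (cases "\<L> = {}")
  case True
  then show ?thesis by (intro exI[of _ "{}"]) auto
next
  case False
  define p where "p v = (SUP l\<in>\<L>. l v)" for v
  have bl: "bounded_linear l" if "l \<in> \<L>" for l
    using linear.scaleR[OF lin[OF that]] linear_add[OF lin[OF that]] bound[OF that]
    by (intro bounded_linear_intro[of l B]) (auto simp: mult.commute)
  have bdd: "bdd_above ((\<lambda>l. l v) ` \<L>)" for v
    using bound by (intro bdd_aboveI2[where M="B * norm v"]) (auto simp: abs_le_iff)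
  have le_p: "l v \<le> p v" if "l \<in> \<L>" for l v
    unfolding p_def by (rule cSUP_upper[OF that bdd])
  have p_le: "p v \<le> c" if "\<And>l. l \<in> \<L> \<Longrightarrow> l v \<le> c" for v c
    unfolding p_def by (rule cSUP_least[OF False that])
  have conv: "convex_on UNIV p"
  proof (rule convex_onI)
    fix t :: real and x y assume t: "0 < t" "t < 1"
    show "p ((1 - t) *\<^sub>R x + t *\<^sub>R y) \<le> (1 - t) * p x + t * p y"
    proof (rule p_le)
      fix l assume l: "l \<in> \<L>"
      have "l ((1 - t) *\<^sub>R x + t *\<^sub>R y) = (1 - t) * l x + t * l y"
        using lin[OF l] by (simp add: linear_add linear_cmul)
      also have "\<dots> \<le> (1 - t) * p x + t * p y"
        using t le_p[OF l] by (intro add_mono mult_left_mono) auto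
      finally show "l ((1 - t) *\<^sub>R x + t *\<^sub>R y) \<le> (1 - t) * p x + t * p y" .
    qed
  qed simp
  have lip: "\<bar>B\<bar>-lipschitz_on UNIV p"
  proof (rule lipschitz_onI)
    have le: "p x \<le> p y + \<bar>B\<bar> * dist x y" for x y
    proof (rule p_le)
      fix l assume l: "l \<in> \<L>"
      have "l x = l y + l (x - y)" using lin[OF l] by (simp add: linear_diff)
      also have "l (x - y) \<le> B * norm (x - y)" using bound[OF l, of "x - y"] by linarith
      also have "\<dots> \<le> \<bar>B\<bar> * dist x y" by (simp add: dist_norm mult_right_mono)
      finally show "l x \<le> p y + \<bar>B\<bar> * dist x y" using le_p[OF l, of y] by linarith
    qed
    show "dist (p x) (p y) \<le> \<bar>B\<bar> * dist x y" for x y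
      using le[of x y] le[of y x] by (simp add: dist_real_def dist_commute abs_le_iff)
  qed simp
  obtain G :: "'v set" where G: "countable G" "closure G = UNIV"
    using sep unfolding separable_space_def by auto
  define kinks where "kinks = (\<lambda>(g, r, s). {f. (\<exists>a\<le>r. \<forall>t. p f + t * a \<le> p (f + t *\<^sub>R g)) \<and>
    (\<exists>b\<ge>s. \<forall>t. p f + t * b \<le> p (f + t *\<^sub>R g))})"
  (* Only triples for which functionals with the required slopes exist; for the others finiteness of the
     tilted minima could fail, and no maximizers have to be covered there. *)
  define I where "I = {(g, r, s). g \<in> G \<and> r \<in> \<rat> \<and> s \<in> \<rat> \<and> r < s \<and> (\<exists>k\<in>\<L>. \<exists>l\<in>\<L>. k g \<le> r \<and> s \<le> l g)}"
  have "I \<subseteq> G \<times> \<rat> \<times> \<rat>" by (auto simp: I_def)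
  then have cI: "countable I" by (rule countable_subset) (intro countable_SIGMA G(1) countable_rat)
  have "\<exists>S. hypersurface S \<and> kinks i \<subseteq> S" if i: "i \<in> I" for i
  proof -
    obtain g r s k l where i: "i = (g, r, s)" and k: "k \<in> \<L>" and l: "l \<in> \<L>"
      and "r < s" "k g \<le> r" "s \<le> l g"
      using i unfolding I_def by blast
    then show ?thesis
      using kinks_in_hypersurface[OF conv lip bl[OF k] bl[OF l] le_p[OF k] le_p[OF l], of g r s]
      by (simp add: kinks_def)
  qed
  then obtain S where S: "\<And>i. i \<in> I \<Longrightarrow> hypersurface (S i)" "\<And>i. i \<in> I \<Longrightarrow> kinks i \<subseteq> S i" by metis
  have cover: "\<exists>i\<in>I. v \<in> kinks i"
    if kl: "k \<in> \<L>" "l \<in> \<L>" "k g < l g" "g \<in> G" and v: "k v = p v" "l v = p v" for k l g v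
  proof -
    obtain r where r: "r \<in> \<rat>" "k g < r" "r < l g" using Rats_dense_in_real[OF kl(3)] by blast
    obtain s where s: "s \<in> \<rat>" "r < s" "s < l g" using Rats_dense_in_real[OF r(3)] by blast
    have slope: "p v + t * m g \<le> p (v + t *\<^sub>R g)" if "m \<in> \<L>" "m v = p v" for m t
      using le_p[OF that(1), of "v + t *\<^sub>R g"] lin[OF that(1)] that(2) by (simp add: linear_add linear_cmul)
    have "(g, r, s) \<in> I" using r s kl by (auto simp: I_def intro: less_imp_le)
    moreover have "v \<in> kinks (g, r, s)"
    proof -
      have "\<exists>a\<le>r. \<forall>t. p v + t * a \<le> p (v + t *\<^sub>R g)"
        using slope[OF kl(1) v(1)] r(2) by (intro exI[of _ "k g"]) simp
      moreover have "\<exists>b\<ge>s. \<forall>t. p v + t * b \<le> p (v + t *\<^sub>R g)"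
        using slope[OF kl(2) v(2)] s(3) by (intro exI[of _ "l g"]) simp
      ultimately show ?thesis by (simp add: kinks_def)
    qed
    ultimately show ?thesis by blast
  qed
  have "v \<in> \<Union> (S ` I)" if v: "k \<in> \<L>" "l \<in> \<L>" "k \<noteq> l" "k v = p v" "l v = p v" for k l v
  proof -
    have "\<exists>g\<in>G. k g \<noteq> l g"
    proof (rule ccontr)
      assume "\<not> ?thesis"
      then have "G \<subseteq> {g. k g = l g}" by blast
      moreover have "closed {g. k g = l g}"
        by (intro closed_Collect_eq bounded_linear.continuous_on[OF bl] v continuous_on_id)
      ultimately have "UNIV \<subseteq> {g. k g = l g}" using closure_minimal G(2) by metis
      then show False using v(3) by auto
    qed
    then obtain g where "g \<in> G" "k g < l g \<or> l g < k g" by force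
    then obtain i where "i \<in> I" "v \<in> kinks i" using cover[of k l g v] cover[of l k g v] v by blast
    then show ?thesis using S(2) by blast
  qed
  then show ?thesis
    using cI S(1) unfolding p_def by (intro exI[of _ "S ` I"]) auto
qed


section \<open>Measures and continuous functions on a compact metrizable space\<close>

text \<open>
  A compact space with a continuous injection into the metric space of real sequences. The
  injection is a homeomorphism onto its image, so it stands in for a metric on a type that only
  carries a topology.
\<close>

locale embedded_compact =
  fixes e :: "'x::topological_space \<Rightarrow> nat \<Rightarrow> real"
  assumes compact_UNIV: "compact (UNIV :: 'x set)"
    and continuous_e: "continuous_on UNIV e"
    and inj_e: "inj e"

text \<open>
  The distances to the points of a countable dense set are coordinates that separate points.
\<close>

lemma embedded_compact_exists:
  assumes comp: "compact (UNIV :: 'x::topological_space set)"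
    and metr: "metrizable_space (euclidean :: 'x topology)"
  shows "\<exists>e :: 'x \<Rightarrow> nat \<Rightarrow> real. embedded_compact e"
proof -
  obtain M and d :: "'x \<Rightarrow> 'x \<Rightarrow> real" where Md: "Metric_space M d"
    and top: "euclidean = Metric_space.mtopology M d"
    using metr unfolding metrizable_space_def by blast
  interpret Metric_space M d by fact
  have M: "M = UNIV" using arg_cong[OF top, of topspace] by simp
  have "compactin euclidean (UNIV :: 'x set)" using comp by simp
  then have "compactin mtopology M" unfolding top M[symmetric] .
  then have "mtotally_bounded M" by (rule compactin_imp_mtotally_bounded)
  moreover have "0 < 1 / real (Suc n)" for n by simp
  ultimately have "\<exists>K. finite K \<and> K \<subseteq> M \<and> M \<subseteq> (\<Union>x\<in>K. mball x (1 / real (Suc n)))" for n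
    unfolding mtotally_bounded_def by blast
  then have "\<exists>K. finite K \<and> UNIV \<subseteq> (\<Union>x\<in>K. mball x (1 / real (Suc n)))" for n
    by (simp only: M) blast
  then obtain K where K: "\<And>n. finite (K n)" "\<And>n. UNIV \<subseteq> (\<Union>x\<in>K n. mball x (1 / real (Suc n)))"
    by metis
  define Q where "Q = (\<Union>n. K n)"
  have "countable Q" using K(1) by (auto simp: Q_def countable_finite)
  have "Q \<noteq> {}" using K(2)[of 0] by (force simp: Q_def)
  define q where "q = from_nat_into Q"
  have q: "range q = Q" using range_from_nat_into[OF \<open>Q \<noteq> {}\<close> \<open>countable Q\<close>] by (simp add: q_def)
  define e where "e x n = d x (q n)" for x n
  have "continuous_on UNIV (\<lambda>x. d x (q n))" for n
  proof -
    have "open ((\<lambda>x. d x (q n)) -` V)" if V: "open V" for V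
    proof -
      have "openin mtopology ((\<lambda>x. d x (q n)) -` V)"
        unfolding openin_mtopology
      proof (intro conjI ballI allI impI)
        fix x assume "x \<in> (\<lambda>x. d x (q n)) -` V"
        then obtain r where r: "0 < r" "\<And>y. dist y (d x (q n)) < r \<Longrightarrow> y \<in> V"
          using V unfolding open_dist by auto
        have le: "\<bar>d y (q n) - d x (q n)\<bar> \<le> d x y" for y
          using triangle[of x y "q n"] triangle[of y x "q n"] commute[of x y] M by simp
        have "mball x r \<subseteq> (\<lambda>x. d x (q n)) -` V"
          using le_less_trans[OF le] by (auto intro!: r(2) simp: dist_real_def)
        then show "\<exists>r>0. mball x r \<subseteq> (\<lambda>x. d x (q n)) -` V" using r(1) by blast
      qed (simp add: M)
      then show ?thesis unfolding open_openin top .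
    qed
    then show ?thesis by (simp add: continuous_on_open_vimage)
  qed
  then have "continuous_on UNIV e" unfolding e_def by (intro continuous_on_coordinatewise_then_product)
  moreover have "inj e"
  proof (rule injI, rule ccontr)
    fix x y assume eq: "e x = e y" and ne: "x \<noteq> y"
    have "0 < d x y" using ne M by simp
    then obtain n where n: "1 / real (Suc n) < d x y / 2" using reals_Archimedean[of "d x y / 2"]
      by (auto simp: inverse_eq_divide)
    obtain z where z: "z \<in> K n" "x \<in> mball z (1 / real (Suc n))" using K(2)[of n] by blast
    then have "z \<in> range q" unfolding q Q_def by blast
    then obtain m where m: "q m = z" by blast
    have "d x z = d y z" using fun_cong[OF eq, of m] by (simp add: e_def m)
    moreover have "d x z < 1 / real (Suc n)" using z by (simp add: commute)
    moreover have "d x y \<le> d x z + d y z" using triangle[of x z y] M commute by simp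
    ultimately show False using n by linarith
  qed
  ultimately show ?thesis using comp by (auto simp: embedded_compact_def)
qed

context embedded_compact
begin

lemma compact_closed: "closed A \<Longrightarrow> compact (A :: 'x set)"
  using compact_UNIV closed_Int_compact[of A UNIV] by simp

lemma closed_image_e: "closed A \<Longrightarrow> closed (e ` A)"
  by (intro compact_imp_closed compact_continuous_image continuous_on_subset[OF continuous_e]
      compact_closed) auto

text \<open>
  The embedding is a closed map, so continuity into the space can be tested after applying it.
\<close>

lemma continuous_on_into:
  assumes "continuous_on S (\<lambda>y. e (f y))"
  shows "continuous_on S f"
  unfolding continuous_on_closed_invariant
proof (intro allI impI)
  fix B :: "'x set" assume "closed B"
  then obtain A where "closed A" "A \<inter> S = (\<lambda>y. e (f y)) -` (e ` B) \<inter> S"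
    using assms closed_image_e unfolding continuous_on_closed_invariant by meson
  moreover have "(\<lambda>y. e (f y)) -` (e ` B) = f -` B" using inj_e by (auto dest: injD)
  ultimately show "\<exists>A. closed A \<and> A \<inter> S = f -` B \<inter> S" by auto
qed

text \<open>
  Obtained as the distance to the set; it replaces the metric in all later approximations.
\<close>

lemma closed_zero_set:
  assumes "closed (A :: 'x set)"
  obtains h :: "'x \<Rightarrow> real" where "continuous_on UNIV h" "\<And>x. 0 \<le> h x" "\<And>x. h x = 0 \<longleftrightarrow> x \<in> A"
proof (cases "A = {}")
  case True
  (* The distance to the empty set is 0 by convention. *)
  then show ?thesis using that[of "\<lambda>_. 1"] by simp
next
  case False
  show ?thesis
  proof (rule that[of "\<lambda>x. infdist (e x) (e ` A)"])
    show "continuous_on UNIV (\<lambda>x. infdist (e x) (e ` A))"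
      by (intro continuous_intros continuous_e)
    show "infdist (e x) (e ` A) = 0 \<longleftrightarrow> x \<in> A" for x
      using in_closed_iff_infdist_zero[OF closed_image_e[OF assms], of "e x"] False inj_e
      by (auto dest: injD)
  qed (rule infdist_nonneg)
qed

lemma bcontfun_of_continuous:
  assumes "continuous_on UNIV (f :: 'x \<Rightarrow> real)"
  obtains F :: "'x \<Rightarrow>\<^sub>C real" where "\<And>x. apply_bcontfun F x = f x"
proof -
  have "bounded (range f)"
    using compact_imp_bounded[OF compact_continuous_image[OF assms compact_UNIV]] .
  then have "f \<in> bcontfun" using assms by (simp add: bcontfun_def)
  then show ?thesis using that[of "Bcontfun f"] by (simp add: Bcontfun_inverse)
qed

text \<open>
  Continuous functions squeezed between the indicators of a closed set and of its shrinking closed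
  neighbourhoods, which turn statements on integrals into statements on measures of closed sets.
\<close>

lemma closed_approximation:
  assumes "closed (A :: 'x set)"
  obtains h :: "'x \<Rightarrow> real" and F :: "nat \<Rightarrow> 'x \<Rightarrow>\<^sub>C real"
    where "continuous_on UNIV h" "\<And>x. 0 \<le> h x" "\<And>x. h x = 0 \<longleftrightarrow> x \<in> A"
    "\<And>k x. indicator A x \<le> apply_bcontfun (F k) x"
    "\<And>k x. apply_bcontfun (F k) x \<le> indicator {x. h x \<le> 1 / real (Suc k)} x"
proof -
  obtain h where h: "continuous_on UNIV h" "\<And>x. 0 \<le> h x" "\<And>x. h x = (0::real) \<longleftrightarrow> x \<in> A"
    by (rule closed_zero_set[OF assms]) blast
  have "\<exists>F. \<forall>x. apply_bcontfun F x = max 0 (1 - real (Suc k) * h x)" for k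
    by (rule bcontfun_of_continuous[of "\<lambda>x. max 0 (1 - real (Suc k) * h x)"])
       (use h(1) in \<open>auto intro!: continuous_intros\<close>)
  then obtain F where F: "\<And>k x. apply_bcontfun (F k) x = max 0 (1 - real (Suc k) * h x)" by metis
  show ?thesis
  proof (rule that[OF h])
    show "indicator A x \<le> apply_bcontfun (F k) x" for k x
      unfolding F using h(3)[of x] by (cases "x \<in> A") simp_all
    show "apply_bcontfun (F k) x \<le> indicator {x. h x \<le> 1 / real (Suc k)} x" for k x
    proof (cases "h x \<le> 1 / real (Suc k)")
      case True
      then show ?thesis unfolding F using h(2)[of x] by simp
    next
      case False
      then have "1 < real (Suc k) * h x" by (simp add: field_simps)
      then show ?thesis unfolding F using False by simp
    qed
  qed
qed

end

lemma borel_probability_measuresD: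
  assumes "\<mu> \<in> borel_probability_measures"
  shows "prob_space \<mu>" "sets \<mu> = sets borel" "space \<mu> = UNIV"
  using assms sets_eq_imp_space_eq[of \<mu> borel] by (auto simp: borel_probability_measures_def)

lemma continuous_bcontfun: "continuous_on UNIV (apply_bcontfun F)"
  using apply_bcontfun[of F] by (simp add: bcontfun_def)

lemma integrable_bcontfun:
  fixes F :: "'x::topological_space \<Rightarrow>\<^sub>C real"
  assumes "\<mu> \<in> borel_probability_measures"
  shows "integrable \<mu> (apply_bcontfun F)" "\<bar>\<integral>x. F x \<partial>\<mu>\<bar> \<le> norm F"
proof -
  interpret prob_space \<mu> by (rule borel_probability_measuresD[OF assms])
  have [measurable]: "apply_bcontfun F \<in> borel_measurable \<mu>"
    using borel_measurable_continuous_onI[OF continuous_bcontfun] borel_probability_measuresD(2)[OF assms]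
    by (simp cong: measurable_cong_sets)
  show int: "integrable \<mu> (apply_bcontfun F)"
    by (rule integrable_const_bound[of _ "norm F"]) (use norm_bounded[of F] in auto)
  have "norm (\<integral>x. F x \<partial>\<mu>) \<le> (\<integral>x. norm (F x) \<partial>\<mu>)" by (rule integral_norm_bound)
  also have "\<dots> \<le> (\<integral>x. norm F \<partial>\<mu>)"
    by (rule integral_mono) (use int norm_bounded[of F] in auto)
  finally have "norm (\<integral>x. F x \<partial>\<mu>) \<le> (\<integral>x. norm F \<partial>\<mu>)" .
  then show "\<bar>\<integral>x. F x \<partial>\<mu>\<bar> \<le> norm F" by (simp add: prob_space)
qed

lemma
  fixes F :: "'x::topological_space \<Rightarrow>\<^sub>C real"
  assumes \<mu>: "\<mu> \<in> borel_probability_measures" and A: "closed A"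
  shows measure_le_integral: "(\<And>x. indicator A x \<le> F x) \<Longrightarrow> measure \<mu> A \<le> (\<integral>x. F x \<partial>\<mu>)"
    and integral_le_measure: "(\<And>x. F x \<le> indicator A x) \<Longrightarrow> (\<integral>x. F x \<partial>\<mu>) \<le> measure \<mu> A"
proof -
  interpret prob_space \<mu> by (rule borel_probability_measuresD[OF \<mu>])
  note [simp] = borel_probability_measuresD(2,3)[OF \<mu>]
  have int: "integrable \<mu> (indicator A :: 'x \<Rightarrow> real)"
    using A by (intro integrable_real_indicator) (auto simp: less_top[symmetric] emeasure_finite)
  have eq: "measure \<mu> A = (\<integral>x. indicator A x \<partial>\<mu>)" by simp
  show "measure \<mu> A \<le> (\<integral>x. F x \<partial>\<mu>)" if "\<And>x. indicator A x \<le> F x"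
    unfolding eq by (rule integral_mono[OF int integrable_bcontfun(1)[OF \<mu>] that])
  show "(\<integral>x. F x \<partial>\<mu>) \<le> measure \<mu> A" if "\<And>x. F x \<le> indicator A x"
    unfolding eq by (rule integral_mono[OF integrable_bcontfun(1)[OF \<mu>] int that])
qed

context embedded_compact
begin

lemma measure_sublevels_tendsto:
  assumes \<mu>: "\<mu> \<in> borel_probability_measures"
    and h: "continuous_on UNIV h" "\<And>x. 0 \<le> h x" "\<And>x::'x. h x = (0::real) \<longleftrightarrow> x \<in> A"
  shows "(\<lambda>k. measure \<mu> {x. h x \<le> 1 / real (Suc k)}) \<longlonglongrightarrow> measure \<mu> A"
proof -
  interpret prob_space \<mu> by (rule borel_probability_measuresD[OF \<mu>])
  have cl: "closed {x. h x \<le> c}" for c by (intro closed_Collect_le h continuous_intros)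
  have eq: "(\<Inter>k. {x. h x \<le> 1 / real (Suc k)}) = A"
  proof -
    have "h x = 0" if "\<forall>k. h x \<le> 1 / real (Suc k)" for x
    proof (rule ccontr)
      assume "h x \<noteq> 0"
      then have "0 < h x" using h(2)[of x] by linarith
      then obtain k where "1 / real (Suc k) < h x" using reals_Archimedean[of "h x"]
        by (auto simp: inverse_eq_divide)
      then show False using that by (meson not_less)
    qed
    moreover have "h x \<le> 1 / real (Suc k)" if "x \<in> A" for x k
      using h(3)[of x] that by simp
    ultimately show ?thesis using h(3) by blast
  qed
  show ?thesis unfolding eq[symmetric]
  proof (rule finite_Lim_measure_decseq)
    show "range (\<lambda>k. {x. h x \<le> 1 / real (Suc k)}) \<subseteq> sets \<mu>"
      using cl borel_probability_measuresD(2)[OF \<mu>] by auto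
    show "decseq (\<lambda>k. {x. h x \<le> 1 / real (Suc k)})"
    proof -
      have "1 / real (Suc (Suc k)) \<le> 1 / real (Suc k)" for k by (simp add: divide_simps)
      then show ?thesis unfolding decseq_Suc_iff by (blast intro: order_trans)
    qed
  qed
qed

text \<open>
  Integrals of continuous functions determine the measure of closed sets by squeezing, and the closed
  sets generate the Borel sets and are stable under intersection.
\<close>

lemma measure_eq_if_integrals_eq:
  assumes \<mu>: "\<mu> \<in> borel_probability_measures" and \<nu>: "\<nu> \<in> borel_probability_measures"
    and eq: "\<And>F :: 'x \<Rightarrow>\<^sub>C real. (\<integral>x. F x \<partial>\<mu>) = (\<integral>x. F x \<partial>\<nu>)"
  shows "\<mu> = \<nu>"
proof -
  have le: "measure \<mu> A \<le> measure \<nu> A"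
    if A: "closed A" and \<mu>\<nu>: "\<mu> \<in> borel_probability_measures" "\<nu> \<in> borel_probability_measures"
      "\<And>F :: 'x \<Rightarrow>\<^sub>C real. (\<integral>x. F x \<partial>\<mu>) = (\<integral>x. F x \<partial>\<nu>)" for A and \<mu> \<nu> :: "'x measure"
  proof -
    obtain h :: "'x \<Rightarrow> real" and F :: "nat \<Rightarrow> 'x \<Rightarrow>\<^sub>C real"
      where h: "continuous_on UNIV h" "\<And>x. 0 \<le> h x" "\<And>x. h x = 0 \<longleftrightarrow> x \<in> A"
      and F: "\<And>k x. indicator A x \<le> apply_bcontfun (F k) x"
      "\<And>k x. apply_bcontfun (F k) x \<le> indicator {x. h x \<le> 1 / real (Suc k)} x"
      by (rule closed_approximation[OF A]) blast
    have "measure \<mu> A \<le> measure \<nu> {x. h x \<le> 1 / real (Suc k)}" for k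
    proof -
      have cl: "closed {x. h x \<le> 1 / real (Suc k)}" by (intro closed_Collect_le h continuous_intros)
      have "measure \<mu> A \<le> (\<integral>x. F k x \<partial>\<mu>)" by (rule measure_le_integral[OF \<mu>\<nu>(1) A F(1)])
      also have "\<dots> = (\<integral>x. F k x \<partial>\<nu>)" by (rule \<mu>\<nu>(3))
      also have "\<dots> \<le> measure \<nu> {x. h x \<le> 1 / real (Suc k)}"
        by (rule integral_le_measure[OF \<mu>\<nu>(2) cl F(2)])
      finally show ?thesis .
    qed
    then show ?thesis
      by (intro LIMSEQ_le_const[OF measure_sublevels_tendsto[OF \<mu>\<nu>(2) h]]) auto
  qed
  have meq: "measure \<mu> A = measure \<nu> A" if "closed A" for A
    using le[OF that \<mu> \<nu> eq] le[OF that \<nu> \<mu> eq[symmetric]] by simp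
  interpret m: prob_space \<mu> by (rule borel_probability_measuresD[OF \<mu>])
  interpret n: prob_space \<nu> by (rule borel_probability_measuresD[OF \<nu>])
  show ?thesis
  proof (rule measure_eqI_generator_eq[where E="Collect closed" and \<Omega>=UNIV and A="\<lambda>_. UNIV"])
    show "Int_stable (Collect closed :: 'x set set)" by (auto simp: Int_stable_def)
    show "emeasure \<mu> X = emeasure \<nu> X" if "X \<in> Collect closed" for X
      using meq that by (simp add: m.emeasure_eq_measure n.emeasure_eq_measure)
    show "sets \<mu> = sigma_sets UNIV (Collect closed)" "sets \<nu> = sigma_sets UNIV (Collect closed)"
      using \<mu> \<nu> by (simp_all add: borel_probability_measuresD borel_eq_closed)
  qed auto
qed

end

section \<open>Weak sequential compactness\<close>

text \<open>
  Membership in the sets \<open>U k\<close> is recorded in the base 3 digits of a real number. With digits 0 and 1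
  only, the tail after the first differing digit cannot compensate that digit.
\<close>

definition ternary_code :: "(nat \<Rightarrow> 'a set) \<Rightarrow> 'a \<Rightarrow> real" where
  "ternary_code U y = (\<Sum>k. indicator (U k) y * (1/3) ^ k)"

lemma summable_ternary: "summable (\<lambda>k. indicator (U k) y * (1/3 :: real) ^ k)"
  by (rule summable_comparison_test'[where g="\<lambda>k. (1/3) ^ k" and N=0])
     (auto intro: summable_geometric simp: indicator_def)

lemma ternary_code_bounds: "0 \<le> ternary_code U y" "ternary_code U y \<le> 3/2"
proof -
  show "0 \<le> ternary_code U y"
    unfolding ternary_code_def by (rule suminf_nonneg[OF summable_ternary]) simp
  have "ternary_code U y \<le> (\<Sum>k. (1/3) ^ k)"
    unfolding ternary_code_def
    by (rule suminf_le[OF _ summable_ternary]) (auto intro: summable_geometric simp: indicator_def)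
  also have "\<dots> = 3/2" by (simp add: suminf_geometric)
  finally show "ternary_code U y \<le> 3/2" .
qed

lemma ternary_code_separates:
  assumes diff: "x \<in> U k \<longleftrightarrow> y \<notin> U k" and k: "k \<le> N"
  shows "(1/3) ^ N / 2 \<le> \<bar>ternary_code U x - ternary_code U y\<bar>"
proof -
  (* The first differing digit contributes \<open>3^-m\<close>, all later ones together at most half of that. *)
  define m where "m = (LEAST k. x \<in> U k \<longleftrightarrow> y \<notin> U k)"
  have m: "x \<in> U m \<longleftrightarrow> y \<notin> U m" "m \<le> N"
    using LeastI[of "\<lambda>k. x \<in> U k \<longleftrightarrow> y \<notin> U k", OF diff]
      Least_le[of "\<lambda>k. x \<in> U k \<longleftrightarrow> y \<notin> U k", OF diff] k by (auto simp: m_def)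
  have below: "x \<in> U j \<longleftrightarrow> y \<in> U j" if "j < m" for j
    using not_less_Least[of j "\<lambda>k. x \<in> U k \<longleftrightarrow> y \<notin> U k"] that by (auto simp: m_def)
  define c where "c j = (indicator (U j) x - indicator (U j) y) * (1/3 :: real) ^ j" for j
  have c: "c = (\<lambda>j. indicator (U j) x * (1/3) ^ j - indicator (U j) y * (1/3) ^ j)"
    by (auto simp: c_def algebra_simps)
  have sc: "summable c" unfolding c by (intro summable_diff summable_ternary)
  have "ternary_code U x - ternary_code U y = suminf c"
    unfolding ternary_code_def c by (intro suminf_diff summable_ternary)
  also have "\<dots> = (\<Sum>j. c (j + Suc m)) + (\<Sum>j<Suc m. c j)"
    by (rule suminf_split_initial_segment[OF sc])
  also have "(\<Sum>j<Suc m. c j) = c m" using below by (simp add: c_def indicator_def)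
  finally have eq: "ternary_code U x - ternary_code U y = (\<Sum>j. c (j + Suc m)) + c m" .
  have cm: "\<bar>c m\<bar> = (1/3) ^ m" using m(1) by (cases "x \<in> U m") (auto simp: c_def abs_mult)
  have bound: "norm (c (j + Suc m)) \<le> (1/3) ^ j * (1/3) ^ Suc m" for j
    by (simp add: c_def abs_mult power_add indicator_def)
  have "norm (\<Sum>j. c (j + Suc m)) \<le> (\<Sum>j. (1/3) ^ j * (1/3 :: real) ^ Suc m)"
    by (rule norm_suminf_le[OF bound]) (intro summable_mult2 summable_geometric, simp)
  also have "\<dots> = (1/3) ^ m / 2"
    by (subst suminf_mult2[symmetric]) (simp_all add: suminf_geometric summable_geometric)
  finally have "(1/3) ^ m / 2 \<le> \<bar>ternary_code U x - ternary_code U y\<bar>"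
    unfolding eq using cm by (simp add: abs_if split: if_splits)
  moreover have "(1/3 :: real) ^ N \<le> (1/3) ^ m" by (rule power_decreasing[OF m(2)]) auto
  ultimately show ?thesis by linarith
qed

text \<open>
  For a countable base \<open>U\<close>, a point is determined by the base sets that contain it, and closeness of
  codes forces closeness of points: finitely many base sets of small diameter cover \<open>K\<close>, and codes
  that agree on their indices belong to points in a common one. Hence the inverse of the
  (in general discontinuous) code is uniformly continuous.
\<close>

lemma compact_borel_code:
  fixes K :: "'a::{metric_space, second_countable_topology} set"
  assumes K: "compact K"
  obtains s :: "'a \<Rightarrow> real" where "s \<in> borel_measurable borel" "\<And>y. 0 \<le> s y" "\<And>y. s y \<le> 3/2"
    "inj_on s K" "uniformly_continuous_on (s ` K) (inv_into K s)"
proof -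
  obtain B :: "'a set set" where B: "countable B" "topological_basis B"
    using ex_countable_basis by blast
  (* The empty set is added only to have a non-empty family to enumerate. *)
  define U where "U = from_nat_into (insert {} B)"
  have U: "range U = insert {} B"
    unfolding U_def by (rule range_from_nat_into) (use B(1) in auto)
  have openU: "open (U k)" for k
    using U topological_basis_open[OF B(2)] by (metis insert_iff open_empty rangeI)
  define s where "s = ternary_code U"
  have fine: "\<exists>\<delta>>0. \<forall>x\<in>K. \<forall>y. \<bar>s x - s y\<bar> < \<delta> \<longrightarrow> dist x y < \<epsilon>" if "\<epsilon> > 0" for \<epsilon>
  proof -
    (* Indices of the base sets of diameter below \<open>\<epsilon>\<close>; finitely many of them cover \<open>K\<close>. *)
    define I where "I = {k. \<forall>x\<in>U k. \<forall>y\<in>U k. dist x y < \<epsilon>}"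
    have "K \<subseteq> (\<Union>k\<in>I. U k)"
    proof
      fix x assume "x \<in> K"
      obtain b where b: "b \<in> B" "x \<in> b" "b \<subseteq> ball x (\<epsilon> / 2)"
        using topological_basisE[OF B(2) open_ball, of x x "\<epsilon> / 2"] \<open>\<epsilon> > 0\<close> by auto
      obtain k where k: "U k = b" using b(1) U by (metis insert_iff rangeE)
      have "dist y z < \<epsilon>" if "y \<in> b" "z \<in> b" for y z
        using subsetD[OF b(3) that(1)] subsetD[OF b(3) that(2)] dist_triangle_half_r[of x y \<epsilon> z] by simp
      then have "k \<in> I" by (auto simp: I_def k)
      then show "x \<in> (\<Union>k\<in>I. U k)" using b(2) k by blast
    qed
    then obtain J where J: "J \<subseteq> I" "finite J" "K \<subseteq> (\<Union>k\<in>J. U k)"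
      using compactE_image[OF K, of I U] openU by metis
    define N where "N = Max (insert 0 J)"
    have "dist x y < \<epsilon>" if x: "x \<in> K" and close: "\<bar>s x - s y\<bar> < (1/3) ^ N / 2" for x y
    proof -
      obtain k where k: "k \<in> J" "x \<in> U k" using J x by blast
      then have "k \<le> N" using J by (simp add: N_def)
      then have "y \<in> U k" using ternary_code_separates[of x U k y N] close k by (force simp: s_def)
      then show ?thesis using k J by (auto simp: I_def)
    qed
    then show ?thesis by (intro exI[of _ "(1/3) ^ N / 2"]) auto
  qed
  have inj: "inj_on s K"
  proof (rule inj_onI, rule ccontr)
    fix x y assume xy: "x \<in> K" "y \<in> K" "s x = s y" "x \<noteq> y"
    then obtain \<delta> where "\<delta> > 0" "\<forall>x'\<in>K. \<forall>y'. \<bar>s x' - s y'\<bar> < \<delta> \<longrightarrow> dist x' y' < dist x y"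
      using fine[of "dist x y"] by auto
    then show False using xy by force
  qed
  show ?thesis
  proof (rule that)
    have [measurable]: "U k \<in> sets borel" for k using openU by simp
    show "s \<in> borel_measurable borel"
      unfolding s_def ternary_code_def by measurable
    show "0 \<le> s y" "s y \<le> 3/2" for y unfolding s_def by (rule ternary_code_bounds)+
    show "inj_on s K" by fact
    show "uniformly_continuous_on (s ` K) (inv_into K s)"
      unfolding uniformly_continuous_on_def
    proof (intro allI impI)
      fix \<epsilon> :: real assume "0 < \<epsilon>"
      then obtain \<delta> where \<delta>: "\<delta> > 0" "\<forall>x\<in>K. \<forall>y. \<bar>s x - s y\<bar> < \<delta> \<longrightarrow> dist x y < \<epsilon>"
        using fine by blast
      then show "\<exists>d>0. \<forall>x\<in>s ` K. \<forall>x'\<in>s ` K. dist x' x < d \<longrightarrow>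
          dist (inv_into K s x') (inv_into K s x) < \<epsilon>"
        using inj by (intro exI[of _ \<delta>]) (auto simp: dist_real_def)
    qed
  qed
qed

text \<open>
  Testing against the bounded continuous function \<open>min 1 (infdist x C)\<close>, which vanishes exactly on \<open>C\<close>.
\<close>

lemma AE_in_limit_of_supports:
  assumes C: "closed C" "C \<noteq> {}"
    and N: "real_distribution N" and \<nu>: "\<And>n. real_distribution (\<nu> n)"
    and conv: "weak_conv_m \<nu> N" and supp: "\<And>n. AE x in \<nu> n. x \<in> C"
  shows "AE x in N. x \<in> C"
proof -
  interpret N: real_distribution N by fact
  interpret \<nu>: real_distribution "\<nu> n" for n by (rule \<nu>)
  let ?f = "\<lambda>x. min 1 (infdist x C)"
  have cont: "continuous_on UNIV ?f" by (intro continuous_intros)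
  have "(\<lambda>n. integral\<^sup>L (\<nu> n) ?f) \<longlonglongrightarrow> integral\<^sup>L N ?f"
    by (rule weak_conv_imp_integral_bdd_continuous_conv[OF \<nu> N conv, of _ 1])
       (use cont in \<open>auto simp: continuous_on_eq_continuous_at infdist_nonneg\<close>)
  moreover have "integral\<^sup>L (\<nu> n) ?f = 0" for n
    by (rule integral_eq_zero_AE) (use supp[of n] in \<open>auto elim: eventually_mono\<close>)
  ultimately have "integral\<^sup>L N ?f = 0" by (simp add: LIMSEQ_const_iff)
  moreover have "integrable N ?f"
    by (rule N.integrable_const_bound[of _ 1])
       (use borel_measurable_continuous_onI[OF cont] in \<open>auto simp: infdist_nonneg\<close>)
  ultimately have "AE x in N. ?f x = 0"
    by (subst (asm) integral_nonneg_eq_0_iff_AE) (auto simp: infdist_nonneg)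
  then show ?thesis
    by (rule eventually_mono)
       (use in_closed_iff_infdist_zero[OF C] in \<open>auto simp: min_def split: if_splits\<close>)
qed

context embedded_compact
begin

text \<open>
  The space is a continuous image, under \<open>\<pi>\<close>, of a closed bounded set \<open>C\<close> of reals, and \<open>S\<close> is a Borel
  section of this map. The image of \<open>\<pi>\<close> stays inside the space since the space is compact, hence closed
  in the space of sequences.
\<close>

lemma borel_section:
  obtains S :: "'x \<Rightarrow> real" and C \<pi> where "S \<in> borel_measurable borel"
    "\<And>x. 0 \<le> S x" "\<And>x. S x \<le> 3/2" "closed C" "\<And>x. S x \<in> C" "continuous_on C \<pi>" "\<And>x. \<pi> (S x) = x"
proof -
  have K: "compact (range e)" by (rule compact_continuous_image[OF continuous_e compact_UNIV])
  obtain s :: "(nat \<Rightarrow> real) \<Rightarrow> real" where s: "s \<in> borel_measurable borel" "\<And>y. 0 \<le> s y" "\<And>y. s y \<le> 3/2"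
    "inj_on s (range e)" "uniformly_continuous_on (s ` range e) (inv_into (range e) s)"
    using compact_borel_code[OF K] by blast
  obtain g where g: "uniformly_continuous_on (closure (s ` range e)) g"
    "\<And>z. z \<in> s ` range e \<Longrightarrow> inv_into (range e) s z = g z"
    using uniformly_continuous_on_extension_on_closure[OF s(5)] by metis
  have gse: "g (s (e x)) = e x" for x using g(2)[of "s (e x)"] s(4) by simp
  have gc: "continuous_on (closure (s ` range e)) g" by (rule uniformly_continuous_imp_continuous[OF g(1)])
  have "g ` closure (s ` range e) \<subseteq> range e"
    by (rule image_closure_subset[OF gc compact_imp_closed[OF K]]) (auto simp: gse)
  then have eg: "e (inv e (g z)) = g z" if "z \<in> closure (s ` range e)" for z
    using that by (auto intro: f_inv_into_f)
  show ?thesis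
  proof (rule that[of "\<lambda>x. s (e x)" "closure (s ` range e)" "\<lambda>z. inv e (g z)"])
    show "(\<lambda>x. s (e x)) \<in> borel_measurable borel"
      by (rule measurable_compose[OF borel_measurable_continuous_onI[OF continuous_e] s(1)])
    show "s (e x) \<in> closure (s ` range e)" for x by (rule subsetD[OF closure_subset]) auto
    show "continuous_on (closure (s ` range e)) (\<lambda>z. inv e (g z))"
      by (rule continuous_on_into) (use gc eg in \<open>simp cong: continuous_on_cong\<close>)
    show "inv e (g (s (e x))) = x" for x by (simp add: gse inj_e)
  qed (use s in auto)
qed

text \<open>
  Helly's theorem for the images under the Borel section. An integrand \<open>F\<close> on the space becomes the
  continuous function \<open>F \<circ> \<pi>\<close> on \<open>C\<close>, which Tietze's theorem extends to the line without
  increasing its bound.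
\<close>

lemma weak_sequential_compactness:
  fixes \<mu> :: "nat \<Rightarrow> 'x measure"
  assumes \<mu>: "\<And>n. \<mu> n \<in> borel_probability_measures"
  obtains r \<nu> where "strict_mono (r :: nat \<Rightarrow> nat)" "\<nu> \<in> borel_probability_measures"
    "\<And>F :: 'x \<Rightarrow>\<^sub>C real. (\<lambda>n. \<integral>x. F x \<partial>\<mu> (r n)) \<longlonglongrightarrow> (\<integral>x. F x \<partial>\<nu>)"
proof -
  obtain S :: "'x \<Rightarrow> real" and C \<pi> where S: "S \<in> borel_measurable borel"
    "\<And>x. 0 \<le> S x" "\<And>x. S x \<le> 3/2" and C: "closed C" "\<And>x. S x \<in> C"
    and \<pi>: "continuous_on C \<pi>" "\<And>x. \<pi> (S x) = x"
    using borel_section by metis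
  define \<kappa> where "\<kappa> n = distr (\<mu> n) borel S" for n
  interpret \<mu>: prob_space "\<mu> n" for n by (rule borel_probability_measuresD[OF \<mu>])
  have [measurable]: "S \<in> borel_measurable (\<mu> n)" for n
    using S(1) by (simp add: borel_probability_measuresD(2)[OF \<mu>] cong: measurable_cong_sets)
  have rd: "real_distribution (\<kappa> n)" for n unfolding \<kappa>_def by (rule \<mu>.real_distribution_distr) simp
  have "tight \<kappa>"
    unfolding tight_def
  proof (intro conjI allI impI rd)
    fix \<epsilon> :: real assume "0 < \<epsilon>"
    have "S -` {- 1<..2} = UNIV"
    proof -
      have "S x \<in> {- 1<..2}" for x using S(2)[of x] S(3)[of x] by simp
      then show ?thesis by blast
    qed
    then have "measure (\<kappa> n) {- 1<..2} = 1" for n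
      unfolding \<kappa>_def using \<mu>.prob_space[of n] by (subst measure_distr) simp_all
    then show "\<exists>a b. a < b \<and> (\<forall>n. 1 - \<epsilon> < measure (\<kappa> n) {a<..b})"
      using \<open>0 < \<epsilon>\<close> by (intro exI[of _ "- 1"] exI[of _ 2]) simp
  qed
  then obtain r N where r: "strict_mono (r :: nat \<Rightarrow> nat)" and N: "real_distribution N"
    and conv: "weak_conv_m (\<kappa> \<circ> id \<circ> r) N"
    using tight_imp_convergent_subsubsequence[of \<kappa> id] by (auto simp: strict_mono_id)
  interpret N: real_distribution N by fact
  have conv': "weak_conv_m (\<lambda>n. \<kappa> (r n)) N" using conv by (simp add: o_def)
  have "AE x in \<kappa> n. x \<in> C" for n
    unfolding \<kappa>_def using C by (subst AE_distr_iff) auto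
  then have AE: "AE x in N. x \<in> C"
    using C by (intro AE_in_limit_of_supports[OF C(1) _ N rd conv']) auto
  (* A total Borel map; it agrees with \<open>\<pi>\<close> almost everywhere since \<open>N\<close> is concentrated on \<open>C\<close>. *)
  define \<pi>' where "\<pi>' = (\<lambda>z. if z \<in> C then \<pi> z else undefined)"
  have \<pi>'[measurable]: "\<pi>' \<in> borel_measurable borel"
    unfolding \<pi>'_def by (rule borel_measurable_continuous_on_if) (use C \<pi> in auto)
  then have \<pi>'N[measurable]: "\<pi>' \<in> borel_measurable N" by (simp cong: measurable_cong_sets)
  define \<nu> where "\<nu> = distr N borel \<pi>'"
  have \<nu>: "\<nu> \<in> borel_probability_measures"
    unfolding \<nu>_def borel_probability_measures_def using N.prob_space_distr[OF \<pi>'N] by simp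
  have "(\<lambda>n. \<integral>x. F x \<partial>\<mu> (r n)) \<longlonglongrightarrow> (\<integral>x. F x \<partial>\<nu>)" for F :: "'x \<Rightarrow>\<^sub>C real"
  proof -
    have cF: "continuous_on UNIV (apply_bcontfun F)" by (rule continuous_bcontfun)
    have "continuous_on C (\<lambda>z. F (\<pi> z))"
      by (rule continuous_on_compose2[OF cF \<pi>(1)]) simp
    then obtain G where G: "continuous_on UNIV G" "\<And>z. z \<in> C \<Longrightarrow> G z = F (\<pi> z)"
      "\<And>z. G z \<in> {- norm F..norm F}"
    proof (rule_tac Tietze_extension_closed_real_interval[of "euclidean :: real topology" C
          "\<lambda>z. F (\<pi> z)" "- norm F" "norm F"])
      show "normal_space (euclidean :: real topology)"
        by (rule metrizable_imp_normal_space[OF metrizable_space_euclidean])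
      show "(\<lambda>z. F (\<pi> z)) ` C \<subseteq> {- norm F..norm F}"
        using norm_bounded[of F] by (auto simp: abs_le_iff minus_le_iff)
    qed (use C in \<open>auto simp: image_subset_iff\<close>)
    have mF: "apply_bcontfun F \<in> borel_measurable borel" by (rule borel_measurable_continuous_onI[OF cF])
    have "(\<lambda>n. integral\<^sup>L (\<kappa> (r n)) G) \<longlonglongrightarrow> integral\<^sup>L N G"
      by (rule weak_conv_imp_integral_bdd_continuous_conv[OF rd N conv', of _ "norm F"])
         (use G in \<open>auto simp: continuous_on_eq_continuous_at abs_le_iff minus_le_iff\<close>)
    moreover have "integral\<^sup>L (\<kappa> n) G = (\<integral>x. F x \<partial>\<mu> n)" for n
      unfolding \<kappa>_def using G C \<pi>
      by (subst integral_distr) (auto intro!: borel_measurable_continuous_onI)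
    moreover have "integral\<^sup>L N G = (\<integral>x. F x \<partial>\<nu>)"
    proof -
      have "(\<integral>x. F x \<partial>\<nu>) = (\<integral>z. F (\<pi>' z) \<partial>N)"
        unfolding \<nu>_def by (rule integral_distr[OF \<pi>'N mF])
      also have "\<dots> = integral\<^sup>L N G"
      proof (rule integral_cong_AE)
        show "(\<lambda>z. F (\<pi>' z)) \<in> borel_measurable N" by (rule measurable_compose[OF \<pi>'N mF])
        show "G \<in> borel_measurable N" using borel_measurable_continuous_onI[OF G(1)] by simp
        show "AE z in N. F (\<pi>' z) = G z" using AE
          by (rule eventually_mono) (simp add: G \<pi>'_def)
      qed
      finally show ?thesis ..
    qed
    ultimately show ?thesis by simp
  qed
  then show ?thesis using that[OF r \<nu>] by blast
qed

end

section \<open>Capacitability of analytic sets\<close>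

text \<open>
  Projections of closed subsets of the product with the Baire space \<open>nat \<Rightarrow> nat\<close>; in Polish spaces
  this is the usual notion of analytic set.
\<close>

definition analytic_set :: "'a::topological_space set \<Rightarrow> bool" where
  "analytic_set A \<longleftrightarrow> (\<exists>R :: ('a \<times> (nat \<Rightarrow> nat)) set. closed R \<and> A = fst ` R)"

lemma continuous_on_snd_coordinate:
  "continuous_on UNIV (\<lambda>p :: 'a::topological_space \<times> (nat \<Rightarrow> nat). snd p m)"
  by (rule continuous_on_product_then_coordinatewise[OF continuous_on_snd[OF continuous_on_id]])

lemma continuous_on_reindex:
  "continuous_on UNIV (\<lambda>p :: 'a::topological_space \<times> (nat \<Rightarrow> nat). (fst p, \<lambda>n. snd p (f n)))"
  by (rule continuous_on_Pair[OF continuous_on_fst[OF continuous_on_id]])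
     (rule continuous_on_coordinatewise_then_product, rule continuous_on_snd_coordinate)

lemma analytic_set_closed: "closed A \<Longrightarrow> analytic_set A"
  unfolding analytic_set_def by (intro exI[of _ "A \<times> UNIV"]) (auto intro: closed_Times)

text \<open>
  The first entry of the sequence chooses the set of the union, the remaining entries are a witness for
  membership in that set.
\<close>

lemma analytic_set_UN:
  assumes "\<And>i :: nat. analytic_set (A i)"
  shows "analytic_set (\<Union>i. A i :: 'a::topological_space set)"
proof -
  have "\<forall>i. \<exists>R :: ('a \<times> (nat \<Rightarrow> nat)) set. closed R \<and> A i = fst ` R"
    using assms unfolding analytic_set_def by blast
  then obtain R :: "nat \<Rightarrow> ('a \<times> (nat \<Rightarrow> nat)) set"
    where R: "\<And>i. closed (R i)" "\<And>i. A i = fst ` R i"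
    unfolding choice_iff by blast
  let ?R = "\<Inter>i. {p. snd p 0 \<in> - {i} \<or> (fst p, \<lambda>n. snd p (Suc n)) \<in> R i}"
  have "closed ?R"
  proof (intro closed_INT ballI closed_Collect_disj)
    fix i :: nat
    have "closed (- {i})" unfolding closed_def by (rule discrete_topology_class.open_discrete)
    from closed_vimage[OF this continuous_on_snd_coordinate, of 0]
    show "closed {p :: 'a \<times> (nat \<Rightarrow> nat). snd p 0 \<in> - {i}}"
      by (simp add: vimage_def)
    show "closed {p. (fst p, \<lambda>n. snd p (Suc n)) \<in> R i}"
      using closed_vimage[OF R(1)[of i] continuous_on_reindex[of Suc]] by (simp add: vimage_def)
  qed
  moreover have "(\<Union>i. A i) = fst ` ?R"
  proof (intro equalityI subsetI)
    fix x assume "x \<in> (\<Union>i. A i)"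
    then obtain i \<tau> where "(x, \<tau>) \<in> R i" using R(2) by auto
    then have "(x, case_nat i \<tau>) \<in> ?R" by auto
    then show "x \<in> fst ` ?R" by (rule image_eqI[rotated]) simp
  next
    fix x assume "x \<in> fst ` ?R"
    then obtain \<tau> where "(x, \<tau>) \<in> ?R" by auto
    then have "(x, \<lambda>n. \<tau> (Suc n)) \<in> R (\<tau> 0)" by auto
    then show "x \<in> (\<Union>i. A i)" using R(2) by force
  qed
  ultimately show ?thesis unfolding analytic_set_def by blast
qed

text \<open>
  A single sequence codes one witness for each of the countably many sets.
\<close>

lemma analytic_set_INT:
  assumes "\<And>i :: nat. analytic_set (A i)"
  shows "analytic_set (\<Inter>i. A i :: 'a::topological_space set)"
proof -
  have "\<forall>i. \<exists>R :: ('a \<times> (nat \<Rightarrow> nat)) set. closed R \<and> A i = fst ` R"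
    using assms unfolding analytic_set_def by blast
  then obtain R :: "nat \<Rightarrow> ('a \<times> (nat \<Rightarrow> nat)) set"
    where R: "\<And>i. closed (R i)" "\<And>i. A i = fst ` R i"
    unfolding choice_iff by blast
  let ?R = "\<Inter>i. {p. (fst p, \<lambda>n. snd p (prod_encode (i, n))) \<in> R i}"
  have "closed ?R"
    using closed_vimage[OF R(1) continuous_on_reindex] by (auto simp: vimage_def)
  moreover have "(\<Inter>i. A i) = fst ` ?R"
  proof (intro equalityI subsetI)
    fix x assume "x \<in> (\<Inter>i. A i)"
    then have "x \<in> fst ` R i" for i using R(2) by blast
    then have "\<forall>i. \<exists>\<tau>. (x, \<tau>) \<in> R i" by force
    then obtain \<tau> where \<tau>: "\<And>i. (x, \<tau> i) \<in> R i" by metis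
    define \<sigma> where "\<sigma> m = (case prod_decode m of (i, n) \<Rightarrow> \<tau> i n)" for m
    have "(\<lambda>n. \<sigma> (prod_encode (i, n))) = \<tau> i" for i by (simp add: \<sigma>_def)
    then have "(x, \<sigma>) \<in> ?R" using \<tau> by simp
    then show "x \<in> fst ` ?R" by (rule image_eqI[rotated]) simp
  next
    fix x assume "x \<in> fst ` ?R"
    then show "x \<in> (\<Inter>i. A i)" using R(2) by force
  qed
  ultimately show ?thesis unfolding analytic_set_def by blast
qed

lemma closed_fst_image_of_compact:
  assumes K: "compact (UNIV :: 'b::topological_space set)"
    and Q: "closed (Q :: ('a::topological_space \<times> 'b) set)"
  shows "closed (fst ` Q)"
  unfolding closed_def
proof (subst open_subopen, rule ballI)
  fix x assume "x \<in> - fst ` Q"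
  then have "(x, y) \<notin> Q" for y by (metis ComplD fst_conv image_eqI)
  then have "{x} \<times> UNIV \<subseteq> - Q" by blast
  then obtain U where U: "x \<in> U" "open U" "U \<times> UNIV \<subseteq> - Q"
    using Elementary_Topology.tube_lemma[OF K, of "- Q" x] Q by (auto simp: open_Compl)
  have "(z, y) \<notin> Q" if "z \<in> U" for z y using subsetD[OF U(3), of "(z, y)"] that by simp
  then have "U \<subseteq> - fst ` Q" by auto
  with U(1,2) show "\<exists>T. open T \<and> x \<in> T \<and> T \<subseteq> - fst ` Q" by blast
qed

text \<open>
  Compactness of the space makes the projection that eliminates \<open>y\<close> a closed map, so only the
  projection along the Baire space remains.
\<close>

lemma analytic_set_relation_preimage:
  fixes G :: "('x::topological_space \<times> 'x) set"
  assumes comp: "compact (UNIV :: 'x set)" and G: "closed G" and A: "analytic_set A"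
  shows "analytic_set {x. \<exists>y\<in>A. (x, y) \<in> G}"
proof -
  obtain R :: "('x \<times> (nat \<Rightarrow> nat)) set" where R: "closed R" "A = fst ` R"
    using A unfolding analytic_set_def by blast
  let ?Q = "{q :: ('x \<times> (nat \<Rightarrow> nat)) \<times> 'x. (fst (fst q), snd q) \<in> G \<and> (snd q, snd (fst q)) \<in> R}"
  have "closed ?Q"
  proof (rule closed_Collect_conj)
    have "continuous_on UNIV (\<lambda>q :: ('x \<times> (nat \<Rightarrow> nat)) \<times> 'x. (fst (fst q), snd q))"
      "continuous_on UNIV (\<lambda>q :: ('x \<times> (nat \<Rightarrow> nat)) \<times> 'x. (snd q, snd (fst q)))"
      by (intro continuous_intros)+
    from closed_vimage[OF G this(1)] closed_vimage[OF R(1) this(2)]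
    show "closed {q :: ('x \<times> (nat \<Rightarrow> nat)) \<times> 'x. (fst (fst q), snd q) \<in> G}"
      "closed {q :: ('x \<times> (nat \<Rightarrow> nat)) \<times> 'x. (snd q, snd (fst q)) \<in> R}"
      by (simp_all add: vimage_def)
  qed
  then have "closed (fst ` ?Q)" by (rule closed_fst_image_of_compact[OF comp])
  moreover have "{x. \<exists>y\<in>A. (x, y) \<in> G} = fst ` fst ` ?Q"
    using R(2) by (force simp: image_iff)
  ultimately show ?thesis unfolding analytic_set_def by blast
qed

context embedded_compact
begin

lemma tendsto_of_embedding:
  assumes "((\<lambda>n. e (y n)) \<longlongrightarrow> e x) F"
  shows "(y \<longlongrightarrow> x) F"
proof (rule topological_tendstoI)
  fix U assume U: "open U" "x \<in> U"
  have "open (- e ` (- U))" by (intro open_Compl closed_image_e closed_Compl U)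
  moreover have "e x \<in> - e ` (- U)" using inj_e U by (auto dest: injD)
  ultimately have "\<forall>\<^sub>F n in F. e (y n) \<in> - e ` (- U)" using topological_tendstoD[OF assms] by blast
  then show "\<forall>\<^sub>F n in F. y n \<in> U" by (rule eventually_mono) auto
qed

text \<open>
  The sets that are analytic together with their complements form a sigma-algebra; it contains the
  closed sets because an open set is a countable union of closed sets.
\<close>

lemma borel_imp_analytic_set:
  assumes "(A :: 'x set) \<in> sets borel"
  shows "analytic_set A"
proof -
  have "A \<in> sigma_sets UNIV (Collect closed)" using assms by (simp add: borel_eq_closed)
  then have "analytic_set A \<and> analytic_set (- A)"
  proof (induction rule: sigma_sets.induct)
    case (Basic A)
    then have A: "closed A" by simp
    obtain h :: "'x \<Rightarrow> real" where h: "continuous_on UNIV h" "\<And>x. 0 \<le> h x" "\<And>x. h x = 0 \<longleftrightarrow> x \<in> A"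
      by (rule closed_zero_set[OF A]) blast
    have "- A = (\<Union>k. {x. 1 / real (Suc k) \<le> h x})"
    proof (intro equalityI subsetI)
      fix x assume "x \<in> - A"
      then have "0 < h x" using h(2)[of x] h(3)[of x] by auto
      then obtain k where "1 / real (Suc k) < h x" using reals_Archimedean[of "h x"]
        by (auto simp: inverse_eq_divide)
      then show "x \<in> (\<Union>k. {x. 1 / real (Suc k) \<le> h x})" by (auto intro: less_imp_le)
    next
      fix x assume "x \<in> (\<Union>k. {x. 1 / real (Suc k) \<le> h x})"
      then obtain k where "1 / real (Suc k) \<le> h x" by blast
      moreover have "0 < 1 / real (Suc k)" by simp
      ultimately have "h x \<noteq> 0" by linarith
      then show "x \<in> - A" using h(3) by blast
    qed
    moreover have "closed {x. 1 / real (Suc k) \<le> h x}" for k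
      by (intro closed_Collect_le h continuous_intros)
    ultimately have "analytic_set (- A)" by (simp only: analytic_set_UN analytic_set_closed)
    then show ?case using analytic_set_closed[OF A] by blast
  next
    case Empty
    then show ?case by (auto intro: analytic_set_closed)
  next
    case (Compl a)
    then show ?case by (simp add: Compl_eq_Diff_UNIV[symmetric])
  next
    case (Union a)
    then show ?case by (auto simp: Compl_UN intro: analytic_set_UN analytic_set_INT)
  qed
  then show ?thesis by blast
qed

text \<open>
  Choquet's argument. Restricting the entries of the witnesses one after the other to finite ranges
  \<open>{..n i}\<close> costs arbitrarily little outer measure, because outer measure is continuous along increasing
  unions of arbitrary sets. Once all entries are restricted, the witnesses range over a compact
  set and the resulting set is closed.
\<close>

lemma analytic_capacitability:
  assumes \<mu>: "\<mu> \<in> borel_probability_measures" and S: "analytic_set (S :: 'x set)"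
    and c: "c < outer_measure_of \<mu> S"
  obtains K where "closed K" "K \<subseteq> S" "c \<le> emeasure \<mu> K"
proof -
  interpret prob_space \<mu> by (rule borel_probability_measuresD[OF \<mu>])
  note [simp] = borel_probability_measuresD(2,3)[OF \<mu>]
  obtain R :: "('x \<times> (nat \<Rightarrow> nat)) set" where R: "closed R" "S = fst ` R"
    using S unfolding analytic_set_def by blast
  (* Points with a witness whose first entries are bounded by the list \<open>ns\<close>. *)
  define B where "B ns = {x. \<exists>\<sigma>. (x, \<sigma>) \<in> R \<and> (\<forall>i<length ns. \<sigma> i \<le> ns ! i)}" for ns
  have step: "\<exists>m. c < outer_measure_of \<mu> (B (ns @ [m]))" if "c < outer_measure_of \<mu> (B ns)" for ns
  proof -
    have app: "B (ns @ [m]) = {x. \<exists>\<sigma>. (x, \<sigma>) \<in> R \<and> (\<forall>i<length ns. \<sigma> i \<le> ns ! i) \<and> \<sigma> (length ns) \<le> m}" for m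
    proof -
      have "(\<forall>i<length (ns @ [m]). \<sigma> i \<le> (ns @ [m]) ! i) \<longleftrightarrow>
          (\<forall>i<length ns. \<sigma> i \<le> ns ! i) \<and> \<sigma> (length ns) \<le> m" for \<sigma>
        by (auto simp: nth_append less_Suc_eq)
      then show ?thesis unfolding B_def by simp
    qed
    have "incseq (\<lambda>m. B (ns @ [m]))"
      unfolding app incseq_def by (auto intro: order_trans)
    then have "(SUP m. outer_measure_of \<mu> (B (ns @ [m]))) = outer_measure_of \<mu> (\<Union>m. B (ns @ [m]))"
      by (intro SUP_outer_measure_of_incseq) auto
    also have "(\<Union>m. B (ns @ [m])) = B ns" unfolding app by (auto simp: B_def)
    finally have "c < (SUP m. outer_measure_of \<mu> (B (ns @ [m])))" using that by simp
    then show ?thesis unfolding less_SUP_iff by blast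
  qed
  have "\<exists>L. \<forall>k. (length (L k) = k \<and> c < outer_measure_of \<mu> (B (L k))) \<and> (\<exists>m. L (Suc k) = L k @ [m])"
  proof (rule dependent_nat_choice)
    have "B [] = S" using R(2) by (force simp: B_def)
    then show "\<exists>ns. length ns = 0 \<and> c < outer_measure_of \<mu> (B ns)" using c by auto
    show "\<exists>ns'. (length ns' = Suc k \<and> c < outer_measure_of \<mu> (B ns')) \<and> (\<exists>m. ns' = ns @ [m])"
      if ns: "length ns = k \<and> c < outer_measure_of \<mu> (B ns)" for ns k
    proof -
      obtain m where "c < outer_measure_of \<mu> (B (ns @ [m]))" using step[of ns] ns by blast
      then show ?thesis using ns by (intro exI[of _ "ns @ [m]"]) auto
    qed
  qed
  then obtain L where L: "\<And>k. length (L k) = k" "\<And>k. c < outer_measure_of \<mu> (B (L k))"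
    "\<And>k. \<exists>m. L (Suc k) = L k @ [m]" by blast
  define n where "n i = L (Suc i) ! i" for i
  have Ln: "L k ! i = n i" if "i < k" for i k
    using that
  proof (induction k)
    case (Suc k)
    obtain m where "L (Suc k) = L k @ [m]" using L(3) by blast
    then show ?case using Suc L(1)[of k] by (cases "i = k") (auto simp: n_def nth_append)
  qed simp
  have BL: "B (L k) = {x. \<exists>\<sigma>. (x, \<sigma>) \<in> R \<and> (\<forall>i<k. \<sigma> i \<le> n i)}" for k
    using L(1)[of k] Ln by (simp add: B_def)
  (* The closures are taken to have measurable sets; a limit argument shows that nothing outside \<open>S\<close>
     is added. *)
  let ?K = "\<Inter>k. closure (B (L k))"
  have "?K \<subseteq> S"
  proof
    fix x assume x: "x \<in> ?K"
    have "\<exists>y \<sigma>. (y, \<sigma>) \<in> R \<and> (\<forall>i<k. \<sigma> i \<le> n i) \<and> dist (e y) (e x) < 1 / real (Suc k)" for k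
    proof -
      let ?U = "{y. dist (e y) (e x) < 1 / real (Suc k)}"
      have "open ?U" by (intro open_Collect_less continuous_intros continuous_e)
      moreover have "x \<in> ?U" by simp
      ultimately have "?U \<inter> B (L k) \<noteq> {}" using x open_Int_closure_eq_empty[of ?U "B (L k)"] by blast
      then show ?thesis unfolding BL by auto
    qed
    then obtain y \<sigma> where y: "\<And>k. (y k, \<sigma> k) \<in> R" "\<And>k i. i < k \<Longrightarrow> \<sigma> k i \<le> n i"
      "\<And>k. dist (e (y k)) (e x) < 1 / real (Suc k)" by metis
    (* The witness \<open>\<sigma> k\<close> obeys the bound \<open>n i\<close> only for \<open>i < k\<close>, so at each index finitely many witnesses
       have to be accommodated separately to place all of them in one compact product. *)
    define b where "b i = Max (insert (n i) ((\<lambda>k. \<sigma> k i) ` {..i}))" for i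
    have "\<sigma> k \<in> PiE UNIV (\<lambda>i. {..b i})" for k
    proof -
      have "\<sigma> k i \<le> b i" for i
      proof (cases "i < k")
        case True
        have "n i \<le> b i" unfolding b_def by (rule Max_ge) auto
        then show ?thesis using y(2)[OF True] by linarith
      next
        case False
        then show ?thesis unfolding b_def by (intro Max_ge) auto
      qed
      then show ?thesis by auto
    qed
    moreover have "compact (PiE UNIV (\<lambda>i. {..b i}))"
    proof -
      have "compactin (product_topology (\<lambda>i. euclidean) UNIV) (PiE UNIV (\<lambda>i. {..b i}))"
        unfolding compactin_PiE by (simp add: finite_imp_compact)
      then show ?thesis by (simp add: euclidean_product_topology)
    qed
    ultimately obtain \<tau> r where r: "strict_mono (r :: nat \<Rightarrow> nat)" "(\<sigma> \<circ> r) \<longlonglongrightarrow> \<tau>"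
      using seq_compactE[OF compact_imp_seq_compact] by metis
    have "(\<lambda>k. dist (e (y k)) (e x)) \<longlonglongrightarrow> 0"
      by (rule tendsto_sandwich[OF _ _ tendsto_const LIMSEQ_Suc[OF lim_1_over_n]])
         (use y(3) in \<open>auto intro!: always_eventually less_imp_le\<close>)
    then have "y \<longlonglongrightarrow> x" by (intro tendsto_of_embedding, subst tendsto_dist_iff)
    then have "(y \<circ> r) \<longlonglongrightarrow> x" by (rule LIMSEQ_subseq_LIMSEQ[OF _ r(1)])
    then have "(\<lambda>k. ((y \<circ> r) k, (\<sigma> \<circ> r) k)) \<longlonglongrightarrow> (x, \<tau>)" using r(2) by (rule tendsto_Pair)
    then have "(x, \<tau>) \<in> R" by (rule closed_sequentially[OF R(1), rotated]) (simp add: y)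
    then show "x \<in> S" using R(2) by force
  qed
  moreover have "c \<le> emeasure \<mu> ?K"
  proof -
    have "decseq (\<lambda>k. closure (B (L k)))"
      unfolding decseq_Suc_iff BL by (intro allI closure_mono) auto
    then have "emeasure \<mu> ?K = (INF k. emeasure \<mu> (closure (B (L k))))"
      by (intro INF_emeasure_decseq[symmetric]) (auto simp: emeasure_finite)
    moreover have "c \<le> emeasure \<mu> (closure (B (L k)))" for k
    proof -
      have "outer_measure_of \<mu> (B (L k)) \<le> outer_measure_of \<mu> (closure (B (L k)))"
        by (rule outer_measure_of_mono[OF closure_subset])
      then show ?thesis using L(2)[of k] by (simp add: outer_measure_of_eq)
    qed
    ultimately show ?thesis by (simp add: le_INF_iff)
  qed
  ultimately show ?thesis using that[of ?K] by blast
qed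

text \<open>
  An analytic set lies between a countable union of closed sets and a Borel set of the same measure.
\<close>

lemma analytic_set_universally_measurable:
  assumes \<mu>: "\<mu> \<in> borel_probability_measures" and S: "analytic_set (S :: 'x set)"
  shows "S \<in> sets (completion \<mu>)"
proof -
  interpret prob_space \<mu> by (rule borel_probability_measuresD[OF \<mu>])
  note [simp] = borel_probability_measuresD(2,3)[OF \<mu>]
  obtain E where E: "E \<in> sets \<mu>" "S \<subseteq> E" "outer_measure_of \<mu> S = emeasure \<mu> E"
    using outer_measure_of_attain[of S \<mu>] by auto
  obtain F where F: "F \<in> sets \<mu>" "F \<subseteq> S" "emeasure \<mu> F = emeasure \<mu> E"
  proof (cases "outer_measure_of \<mu> S = 0")
    case True
    then show ?thesis using that[of "{}"] E by simp
  next
    case False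
    then have "0 < outer_measure_of \<mu> S" by (simp add: zero_less_iff_neq_zero)
    then obtain u where u: "\<And>n. u n < outer_measure_of \<mu> S" "u \<longlonglongrightarrow> outer_measure_of \<mu> S"
      using approx_from_below_dense_linorder by blast
    have "\<exists>K. closed K \<and> K \<subseteq> S \<and> u n \<le> emeasure \<mu> K" for n
      by (rule analytic_capacitability[OF \<mu> S u(1)]) blast
    then obtain K where K: "\<And>n. closed (K n)" "\<And>n. K n \<subseteq> S" "\<And>n :: nat. u n \<le> emeasure \<mu> (K n)" by metis
    have KF: "(\<Union>n. K n) \<in> sets \<mu>" "(\<Union>n. K n) \<subseteq> S" using K by auto
    have "u n \<le> emeasure \<mu> (\<Union>n. K n)" for n
      using K(3)[of n] emeasure_mono[OF _ KF(1), of "K n"] by (auto intro: order_trans)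
    then have "outer_measure_of \<mu> S \<le> emeasure \<mu> (\<Union>n. K n)"
      by (intro LIMSEQ_le_const2[OF u(2)]) auto
    moreover have "emeasure \<mu> (\<Union>n. K n) \<le> emeasure \<mu> E"
      using KF E by (intro emeasure_mono) auto
    ultimately show ?thesis using that[OF KF] E by simp
  qed
  show ?thesis
    by (rule completion.complete_sets_sandwich[of F _ E])
       (use F E in \<open>auto simp: emeasure_completion less_top[symmetric] emeasure_finite\<close>)
qed

end

section \<open>Weak limits of invariant measures\<close>

definition set_valued_preimage :: "('x \<Rightarrow> 'x set) \<Rightarrow> 'x set \<Rightarrow> 'x set" where
  "set_valued_preimage T A = {x. T x \<inter> A \<noteq> {}}"

lemma closed_set_valued_preimage:
  assumes "upper_semicontinuous_map T" "closed A"
  shows "closed (set_valued_preimage T A)"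
proof -
  have "- set_valued_preimage T A = {x. T x \<subseteq> - A}" by (auto simp: set_valued_preimage_def)
  then show ?thesis using assms by (simp add: closed_def upper_semicontinuous_map_def)
qed

context embedded_compact
begin

text \<open>
  A point \<open>y\<close> outside the closed set \<open>T x\<close> is separated from it by open sets, and by upper
  semi-continuity the values of \<open>T\<close> near \<open>x\<close> stay in the neighbourhood of \<open>T x\<close>.
\<close>

lemma closed_graph:
  assumes T: "upper_semicontinuous_map (T :: 'x \<Rightarrow> 'x set)"
  shows "closed {(x, y). y \<in> T x}"
  unfolding closed_def
proof (subst open_subopen, rule ballI)
  fix p assume "p \<in> - {(x, y). y \<in> T x}"
  then obtain x y where p: "p = (x, y)" "y \<notin> T x" by (cases p) auto
  have clT: "closed (T x)" using T by (simp add: upper_semicontinuous_map_def)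
  obtain h :: "'x \<Rightarrow> real" where h: "continuous_on UNIV h" "\<And>z. 0 \<le> h z" "\<And>z. h z = 0 \<longleftrightarrow> z \<in> T x"
    by (rule closed_zero_set[OF clT]) blast
  have hy: "0 < h y" using h(2)[of y] h(3)[of y] p(2) by linarith
  let ?U = "{z. h z < h y / 2}" and ?V = "{z. h y / 2 < h z}"
  have UV: "open ?U" "open ?V" by (intro open_Collect_less h continuous_intros)+
  have "open ({x'. T x' \<subseteq> ?U} \<times> ?V)"
    using T UV by (intro open_Times) (auto simp: upper_semicontinuous_map_def)
  moreover have "T x \<subseteq> ?U"
  proof
    fix z assume "z \<in> T x"
    then have "h z = 0" by (simp add: h(3))
    then show "z \<in> ?U" using hy by simp
  qed
  then have "p \<in> {x'. T x' \<subseteq> ?U} \<times> ?V" using hy p(1) by simp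
  moreover have "{x'. T x' \<subseteq> ?U} \<times> ?V \<subseteq> - {(x, y). y \<in> T x}" by (auto dest!: subsetD)
  ultimately show "\<exists>W. open W \<and> p \<in> W \<and> W \<subseteq> - {(x, y). y \<in> T x}" by blast
qed

text \<open>
  If the compact set \<open>T x\<close> meets every closed neighbourhood of \<open>A\<close>, a point of \<open>T x\<close> at which \<open>h\<close> is
  minimal lies in \<open>A\<close>.
\<close>

lemma Inter_preimages_of_sublevels:
  assumes T: "upper_semicontinuous_map (T :: 'x \<Rightarrow> 'x set)"
    and h: "continuous_on UNIV h" "\<And>x. 0 \<le> h x" "\<And>x. h x = (0::real) \<longleftrightarrow> x \<in> A"
  shows "(\<Inter>k. set_valued_preimage T {x. h x \<le> 1 / real (Suc k)}) = set_valued_preimage T A"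
proof (intro equalityI subsetI)
  fix x assume x: "x \<in> (\<Inter>k. set_valued_preimage T {x. h x \<le> 1 / real (Suc k)})"
  then have ne: "T x \<noteq> {}" by (auto simp: set_valued_preimage_def)
  have "compact (T x)" using T by (intro compact_closed) (simp add: upper_semicontinuous_map_def)
  then obtain y where y: "y \<in> T x" "\<forall>z\<in>T x. h y \<le> h z"
    using continuous_attains_inf[OF _ ne continuous_on_subset[OF h(1)]] by blast
  have "h y \<le> 1 / real (Suc k)" for k
  proof -
    obtain z where "z \<in> T x" "h z \<le> 1 / real (Suc k)" using x by (auto simp: set_valued_preimage_def)
    then show ?thesis using y(2) by (meson order_trans)
  qed
  then have "h y \<le> 0"
    by (intro LIMSEQ_le_const[OF LIMSEQ_Suc[OF lim_1_over_n]]) auto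
  then have "y \<in> A" using h(2)[of y] h(3)[of y] by simp
  then show "x \<in> set_valued_preimage T A" using y(1) by (auto simp: set_valued_preimage_def)
next
  fix x assume "x \<in> set_valued_preimage T A"
  then obtain y where y: "y \<in> T x" "h y = 0" using h(3) by (auto simp: set_valued_preimage_def)
  then have "h y \<le> 1 / real (Suc k)" for k by simp
  then show "x \<in> (\<Inter>k. set_valued_preimage T {x. h x \<le> 1 / real (Suc k)})"
    using y by (auto simp: set_valued_preimage_def)
qed

text \<open>
  For a Borel set \<open>A\<close>, closed sets inside \<open>A\<close> exhaust its measure, and their preimages are contained in
  that of \<open>A\<close>. The latter is measurable for the completed measure because it is analytic; on a
  non-measurable set \<open>emeasure\<close> would be 0.
\<close>

lemma set_valued_invariant_iff_closed:
  fixes T :: "'x \<Rightarrow> 'x set"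
  assumes T: "upper_semicontinuous_map T" and \<mu>: "\<mu> \<in> borel_probability_measures"
  shows "invariant_measure (Set_Valued T :: ('l::topological_space, 'x) dyn_system) \<mu> \<longleftrightarrow>
    (\<forall>A. closed A \<longrightarrow> measure \<mu> A \<le> measure \<mu> (set_valued_preimage T A))"
proof -
  interpret prob_space \<mu> by (rule borel_probability_measuresD[OF \<mu>])
  note [simp] = borel_probability_measuresD(2,3)[OF \<mu>]
  show ?thesis
  proof (intro iffI allI impI)
    fix A :: "'x set"
    assume inv: "invariant_measure (Set_Valued T :: ('l, 'x) dyn_system) \<mu>" and A: "closed A"
    have "emeasure \<mu> A \<le> emeasure (completion \<mu>) (set_valued_preimage T A)"
      using inv A by (simp add: set_valued_preimage_def)
    also have "\<dots> = emeasure \<mu> (set_valued_preimage T A)"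
      using closed_set_valued_preimage[OF T A] by (simp add: emeasure_completion)
    finally show "measure \<mu> A \<le> measure \<mu> (set_valued_preimage T A)"
      by (simp add: emeasure_eq_measure)
  next
    assume le: "\<forall>A. closed A \<longrightarrow> measure \<mu> A \<le> measure \<mu> (set_valued_preimage T A)"
    have "emeasure \<mu> A \<le> emeasure (completion \<mu>) (set_valued_preimage T A)" if A: "A \<in> sets borel" for A
    proof (rule dense_le)
      fix c assume "c < emeasure \<mu> A"
      then have "c < outer_measure_of \<mu> A" using A by simp
      then obtain K where K: "closed K" "K \<subseteq> A" "c \<le> emeasure \<mu> K"
        by (rule analytic_capacitability[OF \<mu> borel_imp_analytic_set[OF A]]) blast
      have "analytic_set {x. \<exists>y\<in>A. (x, y) \<in> {(x, y). y \<in> T x}}"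
        by (rule analytic_set_relation_preimage[OF compact_UNIV closed_graph[OF T] borel_imp_analytic_set[OF A]])
      also have "{x. \<exists>y\<in>A. (x, y) \<in> {(x, y). y \<in> T x}} = set_valued_preimage T A"
        by (auto simp: set_valued_preimage_def)
      finally have meas: "set_valued_preimage T A \<in> sets (completion \<mu>)"
        by (rule analytic_set_universally_measurable[OF \<mu>])
      have "c \<le> emeasure \<mu> (set_valued_preimage T K)"
        using K le by (auto simp: emeasure_eq_measure intro: order_trans ennreal_leI)
      also have "\<dots> = emeasure (completion \<mu>) (set_valued_preimage T K)"
        using closed_set_valued_preimage[OF T K(1)] by (simp add: emeasure_completion)
      also have "\<dots> \<le> emeasure (completion \<mu>) (set_valued_preimage T A)"
        using K(2) meas by (intro emeasure_mono) (auto simp: set_valued_preimage_def)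
      finally show "c \<le> emeasure (completion \<mu>) (set_valued_preimage T A)" .
    qed
    then show "invariant_measure (Set_Valued T :: ('l, 'x) dyn_system) \<mu>"
      by (simp add: set_valued_preimage_def)
  qed
qed

text \<open>
  Upper semi-continuity of the measure of a closed set under weak limits, in the form needed to pass to
  the limit in the invariance inequality.
\<close>

lemma weak_limit_closed_upper_bound:
  fixes \<mu> :: "nat \<Rightarrow> 'x measure" and G :: "'x \<Rightarrow>\<^sub>C real"
  assumes \<mu>: "\<And>n. \<mu> n \<in> borel_probability_measures" and \<nu>: "\<nu> \<in> borel_probability_measures"
    and conv: "\<And>F :: 'x \<Rightarrow>\<^sub>C real. (\<lambda>n. \<integral>x. F x \<partial>\<mu> n) \<longlonglongrightarrow> (\<integral>x. F x \<partial>\<nu>)"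
    and B: "closed B"
    and G: "\<And>n. (\<integral>x. G x \<partial>\<mu> n) \<le> measure (\<mu> n) B"
  shows "(\<integral>x. G x \<partial>\<nu>) \<le> measure \<nu> B"
proof -
  obtain h :: "'x \<Rightarrow> real" and F :: "nat \<Rightarrow> 'x \<Rightarrow>\<^sub>C real"
    where h: "continuous_on UNIV h" "\<And>x. 0 \<le> h x" "\<And>x. h x = 0 \<longleftrightarrow> x \<in> B"
    and F: "\<And>k x. indicator B x \<le> apply_bcontfun (F k) x"
      "\<And>k x. apply_bcontfun (F k) x \<le> indicator {x. h x \<le> 1 / real (Suc k)} x"
    by (rule closed_approximation[OF B]) blast
  have "(\<integral>x. G x \<partial>\<nu>) \<le> measure \<nu> {x. h x \<le> 1 / real (Suc k)}" for k
  proof -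
    have "(\<integral>x. G x \<partial>\<mu> n) \<le> (\<integral>x. F k x \<partial>\<mu> n)" for n
      using order_trans[OF G measure_le_integral[OF \<mu> B F(1)]] .
    then have "(\<integral>x. G x \<partial>\<nu>) \<le> (\<integral>x. F k x \<partial>\<nu>)"
      by (intro LIMSEQ_le[OF conv conv]) auto
    also have "\<dots> \<le> measure \<nu> {x. h x \<le> 1 / real (Suc k)}"
      by (rule integral_le_measure[OF \<nu> _ F(2)]) (intro closed_Collect_le h continuous_intros)
    finally show ?thesis .
  qed
  then show ?thesis by (intro LIMSEQ_le_const[OF measure_sublevels_tendsto[OF \<nu> h]]) auto
qed

text \<open>
  The set \<open>A\<close> is replaced by a closed neighbourhood before passing to the limit, since the measure
  of a closed set may jump up there; shrinking the neighbourhood afterwards recovers \<open>A\<close>.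
\<close>

lemma set_valued_invariance_weak_limit:
  fixes T :: "'x \<Rightarrow> 'x set"
  assumes T: "upper_semicontinuous_map T"
    and \<mu>: "\<And>n. \<mu> n \<in> invariant_measures (Set_Valued T :: ('l::topological_space, 'x) dyn_system)"
    and \<nu>: "\<nu> \<in> borel_probability_measures"
    and conv: "\<And>F :: 'x \<Rightarrow>\<^sub>C real. (\<lambda>n. \<integral>x. F x \<partial>\<mu> n) \<longlonglongrightarrow> (\<integral>x. F x \<partial>\<nu>)"
  shows "invariant_measure (Set_Valued T :: ('l, 'x) dyn_system) \<nu>"
proof -
  have \<mu>p: "\<mu> n \<in> borel_probability_measures" for n using \<mu> by (simp add: invariant_measures_def)
  have inv: "measure (\<mu> n) A \<le> measure (\<mu> n) (set_valued_preimage T A)" if "closed A" for n A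
    using \<mu>[of n] set_valued_invariant_iff_closed[OF T \<mu>p] that by (simp add: invariant_measures_def)
  interpret \<nu>: prob_space \<nu> by (rule borel_probability_measuresD[OF \<nu>])
  have "measure \<nu> A \<le> measure \<nu> (set_valued_preimage T A)" if A: "closed A" for A
  proof -
    obtain h :: "'x \<Rightarrow> real" and F :: "nat \<Rightarrow> 'x \<Rightarrow>\<^sub>C real"
      where h: "continuous_on UNIV h" "\<And>x. 0 \<le> h x" "\<And>x. h x = 0 \<longleftrightarrow> x \<in> A"
      and F: "\<And>k x. indicator A x \<le> apply_bcontfun (F k) x"
        "\<And>k x. apply_bcontfun (F k) x \<le> indicator {x. h x \<le> 1 / real (Suc k)} x"
      by (rule closed_approximation[OF A]) blast
    let ?A = "\<lambda>k. {x. h x \<le> 1 / real (Suc k)}"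
    have clA: "closed (?A k)" for k by (intro closed_Collect_le h continuous_intros)
    have "measure \<nu> A \<le> measure \<nu> (set_valued_preimage T (?A k))" for k
    proof -
      have "(\<integral>x. F k x \<partial>\<mu> n) \<le> measure (\<mu> n) (set_valued_preimage T (?A k))" for n
        using order_trans[OF integral_le_measure[OF \<mu>p clA F(2)] inv[OF clA]] .
      then have "(\<integral>x. F k x \<partial>\<nu>) \<le> measure \<nu> (set_valued_preimage T (?A k))"
        by (intro weak_limit_closed_upper_bound[OF \<mu>p \<nu> conv] closed_set_valued_preimage[OF T clA])
      then show ?thesis using measure_le_integral[OF \<nu> A F(1), of k] by linarith
    qed
    moreover have "(\<lambda>k. measure \<nu> (set_valued_preimage T (?A k))) \<longlonglongrightarrow>
        measure \<nu> (\<Inter>k. set_valued_preimage T (?A k))"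
    proof (rule \<nu>.finite_Lim_measure_decseq)
      show "range (\<lambda>k. set_valued_preimage T (?A k)) \<subseteq> sets \<nu>"
        using closed_set_valued_preimage[OF T clA] borel_probability_measuresD(2)[OF \<nu>] by auto
      have "1 / real (Suc (Suc k)) \<le> 1 / real (Suc k)" for k by (simp add: divide_simps)
      then have "?A (Suc k) \<subseteq> ?A k" for k by (blast intro: order_trans)
      then show "decseq (\<lambda>k. set_valued_preimage T (?A k))"
        unfolding decseq_Suc_iff set_valued_preimage_def by blast
    qed
    ultimately show ?thesis
      unfolding Inter_preimages_of_sublevels[OF T h] by (intro LIMSEQ_le_const) auto
  qed
  then show ?thesis using set_valued_invariant_iff_closed[OF T \<nu>] by blast
qed

lemma continuous_action:
  assumes "topological_action mul u (\<phi> :: 'l::topological_space \<Rightarrow> 'x \<Rightarrow> 'x)"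
  shows "continuous_on UNIV (\<phi> l)"
proof -
  have "continuous_on UNIV (\<lambda>x. (\<lambda>(l, x). \<phi> l x) (l, x))"
    using assms unfolding topological_action_def
    by (intro continuous_on_compose2[of UNIV "\<lambda>(l, x). \<phi> l x" UNIV "\<lambda>x. (l, x)"]) (auto intro: continuous_intros)
  then show ?thesis by simp
qed

lemma invariant_iff_distr:
  assumes f: "continuous_on UNIV (f :: 'x \<Rightarrow> 'x)" and \<mu>: "\<mu> \<in> borel_probability_measures"
  shows "(\<forall>A\<in>sets borel. emeasure \<mu> (f -` A) = emeasure \<mu> A) \<longleftrightarrow> distr \<mu> borel f = \<mu>"
proof -
  note [simp] = borel_probability_measuresD(2,3)[OF \<mu>]
  have m: "f \<in> measurable \<mu> borel"
    using borel_measurable_continuous_onI[OF f] by (simp cong: measurable_cong_sets)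
  have em: "emeasure (distr \<mu> borel f) A = emeasure \<mu> (f -` A)" if "A \<in> sets borel" for A
    using emeasure_distr[OF m that] by simp
  show ?thesis
  proof
    assume "\<forall>A\<in>sets borel. emeasure \<mu> (f -` A) = emeasure \<mu> A"
    then show "distr \<mu> borel f = \<mu>" by (intro measure_eqI) (auto simp: em)
  next
    assume eq: "distr \<mu> borel f = \<mu>"
    show "\<forall>A\<in>sets borel. emeasure \<mu> (f -` A) = emeasure \<mu> A" using em unfolding eq by simp
  qed
qed

lemma distr_fixed_iff_integrals:
  assumes f: "continuous_on UNIV (f :: 'x \<Rightarrow> 'x)" and \<mu>: "\<mu> \<in> borel_probability_measures"
  shows "distr \<mu> borel f = \<mu> \<longleftrightarrow> (\<forall>F :: 'x \<Rightarrow>\<^sub>C real. (\<integral>x. F (f x) \<partial>\<mu>) = (\<integral>x. F x \<partial>\<mu>))"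
proof -
  note [simp] = borel_probability_measuresD(2,3)[OF \<mu>]
  interpret prob_space \<mu> by (rule borel_probability_measuresD[OF \<mu>])
  have m: "f \<in> measurable \<mu> borel"
    using borel_measurable_continuous_onI[OF f] by (simp cong: measurable_cong_sets)
  have int: "(\<integral>x. F x \<partial>distr \<mu> borel f) = (\<integral>x. F (f x) \<partial>\<mu>)" for F :: "'x \<Rightarrow>\<^sub>C real"
    by (rule integral_distr[OF m borel_measurable_continuous_onI[OF continuous_bcontfun]])
  have "distr \<mu> borel f \<in> borel_probability_measures"
    using prob_space_distr[OF m] by (simp add: borel_probability_measures_def)
  then show ?thesis using measure_eq_if_integrals_eq[OF _ \<mu>] int by metis
qed

lemma invariant_measures_weakly_closed:
  fixes D :: "('l::topological_space, 'x) dyn_system"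
  assumes D: "topological_dynamical_system D"
    and \<mu>: "\<And>n. \<mu> n \<in> invariant_measures D" and \<nu>: "\<nu> \<in> borel_probability_measures"
    and conv: "\<And>F :: 'x \<Rightarrow>\<^sub>C real. (\<lambda>n. \<integral>x. F x \<partial>\<mu> n) \<longlonglongrightarrow> (\<integral>x. F x \<partial>\<nu>)"
  shows "\<nu> \<in> invariant_measures D"
proof (cases D)
  case (Set_Valued T)
  then show ?thesis
    using set_valued_invariance_weak_limit[of T \<mu> \<nu>] D \<mu> \<nu> conv by (simp add: invariant_measures_def)
next
  case (Action mul e' \<phi>)
  have \<mu>p: "\<mu> n \<in> borel_probability_measures" for n using \<mu> by (simp add: invariant_measures_def)
  have cont: "continuous_on UNIV (\<phi> l)" for l
    using D continuous_action[of mul e' \<phi>] by (simp add: Action)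
  have fixed: "distr (\<mu> n) borel (\<phi> l) = \<mu> n" for n l
    using \<mu>[of n] invariant_iff_distr[OF cont \<mu>p] by (simp add: Action invariant_measures_def)
  have "distr \<nu> borel (\<phi> l) = \<nu>" for l
    unfolding distr_fixed_iff_integrals[OF cont \<nu>]
  proof
    fix F :: "'x \<Rightarrow>\<^sub>C real"
    have "continuous_on UNIV (\<lambda>x. F (\<phi> l x))"
      by (rule continuous_on_compose2[OF continuous_bcontfun cont]) simp
    then obtain G :: "'x \<Rightarrow>\<^sub>C real" where G: "\<And>x. G x = F (\<phi> l x)"
      by (rule bcontfun_of_continuous) blast
    have "(\<integral>x. G x \<partial>\<mu> n) = (\<integral>x. F x \<partial>\<mu> n)" for n
      using fixed[of n l] unfolding distr_fixed_iff_integrals[OF cont \<mu>p] by (simp add: G)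
    then have "(\<integral>x. G x \<partial>\<nu>) = (\<integral>x. F x \<partial>\<nu>)"
      using conv[of G] conv[of F] by (simp add: LIMSEQ_unique)
    then show "(\<integral>x. F (\<phi> l x) \<partial>\<nu>) = (\<integral>x. F x \<partial>\<nu>)" by (simp add: G)
  qed
  then have "\<forall>A\<in>sets borel. emeasure \<nu> (\<phi> l -` A) = emeasure \<nu> A" for l
    using invariant_iff_distr[OF cont \<nu>] by blast
  then show ?thesis using \<nu> by (simp add: Action invariant_measures_def)
qed

end

section \<open>Maximizing measures\<close>

lemma linear_continuous_imp_bounded_linear:
  fixes f :: "'a::real_normed_vector \<Rightarrow> 'b::real_normed_vector"
  assumes lin: "linear f" and cont: "continuous_on UNIV f"
  shows "bounded_linear f"
proof -
  interpret linear f by fact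
  have "continuous (at 0) f" using cont by (simp add: continuous_on_eq_continuous_at)
  then obtain \<delta> where \<delta>: "\<delta> > 0" "\<And>x. norm x < \<delta> \<Longrightarrow> norm (f x) < 1"
    unfolding continuous_at_eps_delta by (metis dist_0_norm dist_commute zero zero_less_one)
  show ?thesis
  proof (rule bounded_linear_intro[OF add scale])
    fix x
    show "norm (f x) \<le> norm x * (2 / \<delta>)"
    proof (cases "x = 0")
      case False
      define c where "c = \<delta> / (2 * norm x)"
      have c: "c > 0" using \<delta>(1) False by (simp add: c_def)
      have "norm (c *\<^sub>R x) < \<delta>" using \<delta>(1) False by (simp add: c_def)
      then have "norm (f (c *\<^sub>R x)) < 1" by (rule \<delta>(2))
      then have "c * norm (f x) < 1" using c by (simp add: scale)
      then show ?thesis using False \<delta>(1) by (simp add: c_def field_simps)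
    qed (simp add: zero)
  qed
qed

lemma bounded_linear_integral_bcontfun:
  fixes \<mu> :: "'x::topological_space measure"
  assumes "\<mu> \<in> borel_probability_measures"
  shows "bounded_linear (\<lambda>F :: 'x \<Rightarrow>\<^sub>C real. \<integral>x. F x \<partial>\<mu>)"
  by (rule bounded_linear_intro[of _ 1])
     (use integrable_bcontfun[OF assms] in \<open>auto simp: plus_bcontfun.rep_eq scaleR_bcontfun.rep_eq\<close>)

context embedded_compact
begin

text \<open>
  A maximizing sequence has a subsequence that converges weakly to an invariant measure.
\<close>

lemma maximizing_measure_exists:
  fixes D :: "('l::topological_space, 'x) dyn_system" and F :: "'x \<Rightarrow>\<^sub>C real"
  assumes D: "topological_dynamical_system D" and ne: "invariant_measures D \<noteq> {}"
  shows "\<exists>\<mu>. maximizing_measure D F \<mu>"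
proof -
  let ?M = "invariant_measures D" and ?I = "\<lambda>\<mu>. \<integral>x. F x \<partial>\<mu>"
  let ?s = "SUP \<mu>\<in>?M. ?I \<mu>"
  have Mp: "\<mu> \<in> borel_probability_measures" if "\<mu> \<in> ?M" for \<mu>
    using that by (simp add: invariant_measures_def)
  have bdd: "bdd_above (?I ` ?M)"
    using integrable_bcontfun(2)[OF Mp, of _ F] by (intro bdd_aboveI2[where M="norm F"]) (auto simp: abs_le_iff)
  have "\<exists>\<mu>\<in>?M. ?s - 1 / real (Suc n) < ?I \<mu>" for n
    using less_cSUP_iff[OF ne bdd, of "?s - 1 / real (Suc n)"] by simp
  then obtain \<mu> where \<mu>: "\<And>n. \<mu> n \<in> ?M" "\<And>n. ?s - 1 / real (Suc n) < ?I (\<mu> n)" by metis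
  have lim: "(\<lambda>n. ?I (\<mu> n)) \<longlonglongrightarrow> ?s"
  proof (rule tendsto_sandwich)
    show "(\<lambda>n. ?s - 1 / real (Suc n)) \<longlonglongrightarrow> ?s"
      using tendsto_diff[OF tendsto_const LIMSEQ_Suc[OF lim_1_over_n], of ?s] by simp
    show "\<forall>\<^sub>F n in sequentially. ?I (\<mu> n) \<le> ?s"
      using cSUP_upper[OF \<mu>(1) bdd] by simp
  qed (use \<mu>(2) in \<open>auto intro!: always_eventually less_imp_le\<close>)
  obtain r \<nu> where r: "strict_mono (r :: nat \<Rightarrow> nat)" and \<nu>: "\<nu> \<in> borel_probability_measures"
    and conv: "\<And>F :: 'x \<Rightarrow>\<^sub>C real. (\<lambda>n. \<integral>x. F x \<partial>\<mu> (r n)) \<longlonglongrightarrow> (\<integral>x. F x \<partial>\<nu>)"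
    by (rule weak_sequential_compactness[of \<mu>, OF Mp[OF \<mu>(1)]]) blast
  have "\<nu> \<in> ?M" by (rule invariant_measures_weakly_closed[where \<mu>="\<lambda>n. \<mu> (r n)", OF D \<mu>(1) \<nu> conv])
  moreover have "?I \<nu> = ?s"
    using LIMSEQ_unique[OF conv[of F] LIMSEQ_subseq_LIMSEQ[OF lim r, unfolded o_def]] .
  ultimately show ?thesis unfolding maximizing_measure_def by blast
qed

text \<open>
  By density of the range of \<open>J\<close>, the integrals of all continuous functions agree.
\<close>

lemma measure_eq_if_embedded_integrals_eq:
  assumes J: "closure (range J) = (UNIV :: ('x \<Rightarrow>\<^sub>C real) set)"
    and \<mu>: "\<mu> \<in> borel_probability_measures" and \<nu>: "\<nu> \<in> borel_probability_measures"
    and eq: "\<And>v. (\<integral>x. J v x \<partial>\<mu>) = (\<integral>x. J v x \<partial>\<nu>)"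
  shows "\<mu> = \<nu>"
proof (rule measure_eq_if_integrals_eq[OF \<mu> \<nu>])
  let ?E = "{F :: 'x \<Rightarrow>\<^sub>C real. (\<integral>x. F x \<partial>\<mu>) = (\<integral>x. F x \<partial>\<nu>)}"
  have "closed ?E"
    by (intro closed_Collect_eq bounded_linear.continuous_on[OF bounded_linear_integral_bcontfun]
        \<mu> \<nu> continuous_on_id)
  moreover have "range J \<subseteq> ?E" using eq by auto
  ultimately have "UNIV \<subseteq> ?E" using closure_minimal J by metis
  then show "(\<integral>x. F x \<partial>\<mu>) = (\<integral>x. F x \<partial>\<nu>)" for F :: "'x \<Rightarrow>\<^sub>C real" by blast
qed

end

theorem theorem2:
  fixes D :: "('l::topological_space, 'x::topological_space) dyn_system"
    and J :: "'v::banach \<Rightarrow> ('x \<Rightarrow>\<^sub>C real)"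
  assumes "compact (UNIV :: 'x set)"
    and "metrizable_space (euclidean :: 'x topology)"
    and "topological_dynamical_system D"
    and "invariant_measures D \<noteq> {}"
    and "separable_space (euclidean :: 'v topology)"
    and "dense_continuous_embedding J"
  shows "\<exists>\<H> :: 'v set set. countable \<H> \<and> (\<forall>S\<in>\<H>. hypersurface S) \<and>
           - uniquely_maximized D J \<subseteq> \<Union>\<H>"
proof -
  obtain e :: "'x \<Rightarrow> nat \<Rightarrow> real" where "embedded_compact e"
    using embedded_compact_exists[OF assms(1,2)] by blast
  then interpret embedded_compact e .
  let ?M = "invariant_measures D"
  define ev where "ev \<mu> v = (\<integral>x. J v x \<partial>\<mu>)" for \<mu> v
  have Mp: "\<mu> \<in> borel_probability_measures" if "\<mu> \<in> ?M" for \<mu>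
    using that by (simp add: invariant_measures_def)
  have J: "bounded_linear J" "closure (range J) = UNIV"
    using assms(6) by (auto simp: dense_continuous_embedding_def intro: linear_continuous_imp_bounded_linear)
  obtain B where B: "\<And>v. norm (J v) \<le> norm v * B" using bounded_linear.bounded[OF J(1)] by blast
  have lin: "linear l" and bound: "\<bar>l v\<bar> \<le> B * norm v" if "l \<in> ev ` ?M" for l v
  proof -
    obtain \<mu> where \<mu>: "\<mu> \<in> ?M" "l = ev \<mu>" using \<open>l \<in> ev ` ?M\<close> by blast
    show "linear l"
      using bounded_linear.linear[OF bounded_linear_compose[OF bounded_linear_integral_bcontfun[OF Mp[OF \<mu>(1)]] J(1)]]
      by (simp add: \<mu>(2) ev_def[abs_def])
    show "\<bar>l v\<bar> \<le> B * norm v"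
      using integrable_bcontfun(2)[OF Mp[OF \<mu>(1)], of "J v"] B[of v] by (simp add: \<mu>(2) ev_def mult.commute)
  qed
  have sup: "(SUP l\<in>ev ` ?M. l v) = (SUP \<mu>\<in>?M. \<integral>x. J v x \<partial>\<mu>)" for v
    by (simp add: image_image ev_def)
  have "- uniquely_maximized D J \<subseteq>
    {v. \<exists>k\<in>ev ` ?M. \<exists>l\<in>ev ` ?M. k \<noteq> l \<and> k v = (SUP l\<in>ev ` ?M. l v) \<and> l v = (SUP l\<in>ev ` ?M. l v)}"
  proof
    fix v assume "v \<in> - uniquely_maximized D J"
    then have "\<not> (\<exists>!\<mu>. maximizing_measure D (J v) \<mu>)" by (simp add: uniquely_maximized_def)
    moreover obtain \<mu> where \<mu>: "maximizing_measure D (J v) \<mu>"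
      using maximizing_measure_exists[OF assms(3,4)] by blast
    ultimately obtain \<nu> where \<nu>: "maximizing_measure D (J v) \<nu>" "\<mu> \<noteq> \<nu>" by metis
    have "ev \<mu> \<noteq> ev \<nu>"
    proof
      assume "ev \<mu> = ev \<nu>"
      then have "(\<integral>x. J w x \<partial>\<mu>) = (\<integral>x. J w x \<partial>\<nu>)" for w by (simp add: ev_def fun_eq_iff)
      then show False
        using measure_eq_if_embedded_integrals_eq[OF J(2)] \<mu> \<nu> Mp by (auto simp: maximizing_measure_def)
    qed
    then show "v \<in> {v. \<exists>k\<in>ev ` ?M. \<exists>l\<in>ev ` ?M. k \<noteq> l \<and> k v = (SUP l\<in>ev ` ?M. l v) \<and>
        l v = (SUP l\<in>ev ` ?M. l v)}"
      using \<mu> \<nu>(1) unfolding sup maximizing_measure_def by (auto simp: ev_def)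
  qed
  then show ?thesis
    using nonunique_maximizers_covered[OF assms(5), of "ev ` ?M" B] lin bound by (meson order_trans)
qed

end
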